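(* Let $a,b,m$ be positive integers and let $f\in\mathbb R[x,y]$ be a weighted homogeneous polynomial of type $(a,b;m)$, i.e. $f(\lambda^a x,\lambda^b y)=\lambda^m f(x,y)$ for all $\lambda\in\mathbb R$, with an isolated singularity at the origin. Let $s_0\in(-1,0)$ be a root of the Bernstein–Sato polynomial $b_f(s)$ of $f$. Then the following are equivalent: (1) There exists a test function $\varphi\in C_c^\infty(\mathbb R^2)$ such that $s_0$ is a pole of the meromorphic continuation to $\{\operatorname{Re} s>-1\}$ of the real Archimedean zeta function $$Z_{f,\varphi}(s)=\int_{\mathbb R^2}|f(x,y)|^s\varphi(x,y)\,\mathrm dx\,\mathrm dy,\qquad \operatorname{Re} s>0.$$ (2) There exist non-negative integers $j,k$ such that $$-ms_0=(j+1)\,a+(k+1)\,b$$ and $$\int_{\mathbb R}\left(|f(1,u)|^{s_0}+(-1)^j|f(-1,u)|^{s_0}\right)u^k\,\mathrm du\neq 0.$$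
   Context: $C_c^\infty(\mathbb R^2)$ denotes the compactly supported, real-valued, smooth functions on $\mathbb R^2$. Isolated singularity at the origin: the origin is a singular point of $f$ (so $f$ and its first partial derivatives vanish there) and the Milnor algebra $\mathbb R[x,y]/(\partial_x f,\partial_y f)$ is finite-dimensional over $\mathbb R$. Bernstein–Sato polynomial: for $f\in\mathbb R[x_1,\dots,x_n]$, $b_f(s)$ is the monic generator of the (non-zero) ideal of $\mathbb R[s]$ consisting of all $b(s)$ for which there exists a differential operator $\mathcal D\in\mathbb R[s,x_1,\dots,x_n,\frac{\partial}{\partial x_1},\dots,\frac{\partial}{\partial x_n}]$ with $\mathcal D\cdot f^{s+1}=b(s)\cdot f^s$. Meromorphic continuation: for each test function $\varphi$, the integral $Z_{f,\varphi}(s)$ is holomorphic on $\{\operatorname{Re} s>0\}$ and, using the functional equation $\mathcal D\cdot f^{s+1}=b_f(s) f^s$ and integration by parts, it extends (uniquely) to a meromorphic function on $\{\operatorname{Re} s>-1\}$; "pole" refers to this continuation. *)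

theory Defs
  imports
    "HOL-Complex_Analysis.Complex_Analysis"
    "HOL-Computational_Algebra.Polynomial"
    "HOL-Computational_Algebra.Fraction_Field"
begin

section \<open>Polynomials in two variables\<close>

text \<open>An element of \<open>'a poly poly\<close> is read as a polynomial in \<open>x, y\<close> over \<open>'a\<close>: the outer
  variable is \<open>y\<close>, the inner one is \<open>x\<close>.  Hence \<open>real poly poly\<close> is \<open>\<real>[x,y]\<close>, and
  \<open>real poly poly poly\<close> is \<open>\<real>[s][x,y]\<close>, with \<open>s\<close> innermost.\<close>

definition poly2 :: "'a::comm_ring_1 poly poly \<Rightarrow> 'a \<Rightarrow> 'a \<Rightarrow> 'a" where
  "poly2 f x y = poly (poly f [:y:]) x"

definition dX :: "'a::idom poly poly \<Rightarrow> 'a poly poly" where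
  "dX = map_poly pderiv"

definition dY :: "'a::idom poly poly \<Rightarrow> 'a poly poly" where
  "dY = pderiv"

lemma poly2_monom: "poly2 (monom (monom c i) j) x y = c * x ^ i * y ^ j"
  by (simp add: poly2_def poly_monom poly_power)

lemma dX_monom: "dX (monom (monom c i) j) = monom (monom (of_nat i * c) (i - 1)) j"
  by (simp add: dX_def map_poly_monom pderiv_monom)

lemma dY_monom: "dY (monom (monom c i) j) = monom (monom (of_nat j * c) i) (j - 1)"
  by (simp add: dY_def pderiv_monom of_nat_poly smult_monom)

lemma dX_add: "dX (p + q) = dX p + dX q"
  by (intro poly_eqI) (simp add: dX_def coeff_map_poly pderiv_add)

lemma dY_add: "dY (p + q) = dY p + dY q"
  by (simp add: dY_def pderiv_add)

lemma pderiv_sum: "pderiv (sum g A) = (\<Sum>i\<in>A. pderiv (g i))"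
  by (induction A rule: infinite_finite_induct) (simp_all add: pderiv_add)

lemma dX_mult: "dX (p * q) = dX p * q + p * dX q"
proof (rule poly_eqI)
  fix n
  have "pderiv (\<Sum>i\<le>n. coeff p i * coeff q (n - i)) =
      (\<Sum>i\<le>n. pderiv (coeff p i) * coeff q (n - i)) + (\<Sum>i\<le>n. coeff p i * pderiv (coeff q (n - i)))"
    by (simp add: pderiv_sum pderiv_mult sum.distrib[symmetric] algebra_simps)
  then show "coeff (dX (p * q)) n = coeff (dX p * q + p * dX q) n"
    by (simp add: dX_def coeff_map_poly coeff_mult)
qed

lemma dY_mult: "dY (p * q) = dY p * q + p * dY q"
  by (simp add: dY_def pderiv_mult algebra_simps)


section \<open>Weighted homogeneity and isolated singularities\<close>

definition weighted_homogeneous :: "nat \<Rightarrow> nat \<Rightarrow> nat \<Rightarrow> real poly poly \<Rightarrow> bool" where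
  "weighted_homogeneous a b m f \<longleftrightarrow>
     (\<forall>c x y. poly2 f (c ^ a * x) (c ^ b * y) = c ^ m * poly2 f x y)"

definition jacobian_ideal :: "real poly poly \<Rightarrow> real poly poly set" where
  "jacobian_ideal f = {g * dX f + h * dY f | g h. True}"

definition jacobian_cong :: "real poly poly \<Rightarrow> (real poly poly \<times> real poly poly) set" where
  "jacobian_cong f = {(p, q). p - q \<in> jacobian_ideal f}"

definition milnor_algebra :: "real poly poly \<Rightarrow> real poly poly set set" where
  "milnor_algebra f = UNIV // jacobian_cong f"

definition scale2 :: "real \<Rightarrow> real poly poly \<Rightarrow> real poly poly" where
  "scale2 c p = smult [:c:] p"

interpretation scale2: vector_space scale2
  by unfold_locales (auto simp: scale2_def smult_add_right mult.commute simp flip: smult_add_left one_pCons)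

lemma equiv_jacobian_cong: "equiv UNIV (jacobian_cong f)"
proof (rule equivI)
  have I0: "0 \<in> jacobian_ideal f"
    unfolding jacobian_ideal_def by (auto intro!: exI[of _ 0])
  have Iadd: "p + q \<in> jacobian_ideal f" if "p \<in> jacobian_ideal f" "q \<in> jacobian_ideal f" for p q
  proof -
    from that obtain g h g' h'
      where "p = g * dX f + h * dY f" "q = g' * dX f + h' * dY f"
      unfolding jacobian_ideal_def by blast
    then have "p + q = (g + g') * dX f + (h + h') * dY f" by (simp add: algebra_simps)
    then show ?thesis unfolding jacobian_ideal_def by blast
  qed
  have Iminus: "- p \<in> jacobian_ideal f" if "p \<in> jacobian_ideal f" for p
  proof -
    from that obtain g h where "p = g * dX f + h * dY f" unfolding jacobian_ideal_def by blast
    then have "- p = (- g) * dX f + (- h) * dY f" by simp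
    then show ?thesis unfolding jacobian_ideal_def by blast
  qed
  show "jacobian_cong f \<subseteq> UNIV \<times> UNIV" by simp
  show "refl (jacobian_cong f)"
    by (auto simp: refl_on_def jacobian_cong_def I0)
  show "sym (jacobian_cong f)"
    using Iminus by (fastforce simp: sym_def jacobian_cong_def)
  show "trans (jacobian_cong f)"
    using Iadd by (fastforce simp: trans_def jacobian_cong_def)
qed

text \<open>The quotient is spanned over \<open>\<real>\<close> by the classes of finitely many polynomials.\<close>

definition milnor_algebra_finite_dim :: "real poly poly \<Rightarrow> bool" where
  "milnor_algebra_finite_dim f \<longleftrightarrow>
     (\<exists>B. finite B \<and> milnor_algebra f = (\<lambda>p. jacobian_cong f `` {p}) ` scale2.span B)"

definition isolated_singularity_at_origin :: "real poly poly \<Rightarrow> bool" where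
  "isolated_singularity_at_origin f \<longleftrightarrow>
     poly2 f 0 0 = 0 \<and> poly2 (dX f) 0 0 = 0 \<and> poly2 (dY f) 0 0 = 0 \<and> milnor_algebra_finite_dim f"


section \<open>The Bernstein--Sato polynomial\<close>

definition fract_deriv :: "('a::idom \<Rightarrow> 'a) \<Rightarrow> 'a fract \<Rightarrow> 'a fract" where
  "fract_deriv d z =
     (THE w. \<exists>p q. q \<noteq> 0 \<and> z = Fract p q \<and> w = Fract (d p * q - p * d q) (q * q))"

lemma fract_deriv_Fract:
  assumes d: "\<And>p q. d (p * q) = d p * q + p * d q" and q: "q \<noteq> 0"
  shows "fract_deriv d (Fract p q) = Fract (d p * q - p * d q) (q * q)"
  unfolding fract_deriv_def
proof (rule the_equality)
  fix w assume "\<exists>p' q'. q' \<noteq> 0 \<and> Fract p q = Fract p' q' \<and> w = Fract (d p' * q' - p' * d q') (q' * q')"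
  then obtain p' q' where q': "q' \<noteq> 0" and eq: "Fract p q = Fract p' q'"
    and w: "w = Fract (d p' * q' - p' * d q') (q' * q')" by blast
  from eq q q' have e: "p * q' = p' * q" by (simp add: eq_fract)
  have de: "d p * q' + p * d q' = d p' * q + p' * d q" by (metis d e)
  have "(d p' * q' - p' * d q') * (q * q) = (d p' * q) * (q * q') - (p' * q) * (q * d q')"
    by (simp add: algebra_simps)
  also have "\<dots> = (d p * q' + p * d q' - p' * d q) * (q * q') - (p * q') * (q * d q')"
    using de e by (simp add: algebra_simps)
  also have "\<dots> = d p * q * (q' * q') - (p' * q) * d q * q'"
    by (simp add: algebra_simps)
  also have "\<dots> = (d p * q - p * d q) * (q' * q')"
    using e[symmetric] by (simp add: algebra_simps)
  finally show "w = Fract (d p * q - p * d q) (q * q)"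
    using q q' w by (simp add: eq_fract)
qed (use q in blast)

text \<open>The module \<open>\<real>[s,x,y,1/f] f\<^sup>s\<close> is free of rank one on \<open>f\<^sup>s\<close>; we represent
  \<open>g \<cdot> f\<^sup>s\<close> by its coefficient \<open>g\<close>, viewed in the field \<open>\<real>(s,x,y)\<close>, in particular
  \<open>f\<^sup>s\<close> by \<open>1\<close> and \<open>f\<^sup>s\<^sup>+\<^sup>1\<close> by \<open>f\<close>.  On coefficients, \<open>\<partial>\<close> acts by
  \<open>\<partial>(g f\<^sup>s) = (\<partial>g + s g \<partial>f / f) f\<^sup>s\<close>.\<close>

type_synonym rat_sxy = "real poly poly poly fract"

definition with_s :: "real poly poly \<Rightarrow> real poly poly poly" where
  "with_s f = map_poly (map_poly (\<lambda>c. [:c:])) f"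

definition s_poly :: "real poly \<Rightarrow> real poly poly poly" where
  "s_poly b = [:[:b:]:]"

definition twisted_deriv ::
  "(real poly poly poly \<Rightarrow> real poly poly poly) \<Rightarrow> real poly poly \<Rightarrow> rat_sxy \<Rightarrow> rat_sxy" where
  "twisted_deriv d f g =
     fract_deriv d g + Fract (s_poly [:0, 1:]) 1 * g * Fract (d (with_s f)) (with_s f)"

text \<open>The operators through which \<open>\<real>[s,x,y,\<partial>/\<partial>x,\<partial>/\<partial>y]\<close> acts on this module.\<close>

inductive_set diff_ops :: "real poly poly \<Rightarrow> (rat_sxy \<Rightarrow> rat_sxy) set" for f where
  mult: "(\<lambda>g. Fract p 1 * g) \<in> diff_ops f"
| del_x: "twisted_deriv dX f \<in> diff_ops f"
| del_y: "twisted_deriv dY f \<in> diff_ops f"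
| add: "D \<in> diff_ops f \<Longrightarrow> E \<in> diff_ops f \<Longrightarrow> (\<lambda>g. D g + E g) \<in> diff_ops f"
| comp: "D \<in> diff_ops f \<Longrightarrow> E \<in> diff_ops f \<Longrightarrow> (\<lambda>g. D (E g)) \<in> diff_ops f"

definition bernstein_sato_ideal :: "real poly poly \<Rightarrow> real poly set" where
  "bernstein_sato_ideal f =
     {b. \<exists>D\<in>diff_ops f. D (Fract (with_s f) 1) = Fract (s_poly b) 1}"

definition bernstein_sato_poly :: "real poly poly \<Rightarrow> real poly" where
  "bernstein_sato_poly f =
     (THE b. lead_coeff b = 1 \<and> bernstein_sato_ideal f = {q * b | q. True})"

lemma bernstein_sato_idealI:
  "D \<in> diff_ops f \<Longrightarrow> D (Fract (with_s f) 1) = Fract (s_poly b) 1 \<Longrightarrow> b \<in> bernstein_sato_ideal f"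
  unfolding bernstein_sato_ideal_def mem_Collect_eq by (rule bexI)

lemma bernstein_sato_idealE:
  assumes "b \<in> bernstein_sato_ideal f"
  obtains D where "D \<in> diff_ops f" "D (Fract (with_s f) 1) = Fract (s_poly b) 1"
  using assms unfolding bernstein_sato_ideal_def mem_Collect_eq by (elim bexE)

lemma bernstein_sato_ideal_0: "0 \<in> bernstein_sato_ideal f"
  by (rule bernstein_sato_idealI[OF diff_ops.mult[of 0]]) (simp add: s_poly_def)

lemma bernstein_sato_ideal_add:
  assumes "b \<in> bernstein_sato_ideal f" "c \<in> bernstein_sato_ideal f"
  shows "b + c \<in> bernstein_sato_ideal f"
proof -
  obtain D where D: "D \<in> diff_ops f" "D (Fract (with_s f) 1) = Fract (s_poly b) 1"
    using assms(1) by (rule bernstein_sato_idealE)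
  obtain E where E: "E \<in> diff_ops f" "E (Fract (with_s f) 1) = Fract (s_poly c) 1"
    using assms(2) by (rule bernstein_sato_idealE)
  have "Fract (s_poly b) 1 + Fract (s_poly c) 1 = Fract (s_poly (b + c)) 1"
    by (simp add: s_poly_def)
  then show ?thesis
    by (intro bernstein_sato_idealI[OF diff_ops.add[OF D(1) E(1)]]) (simp only: D(2) E(2))
qed

lemma bernstein_sato_ideal_mult:
  assumes "b \<in> bernstein_sato_ideal f"
  shows "q * b \<in> bernstein_sato_ideal f"
proof -
  obtain D where D: "D \<in> diff_ops f" "D (Fract (with_s f) 1) = Fract (s_poly b) 1"
    using assms by (rule bernstein_sato_idealE)
  have "Fract (s_poly q) 1 * Fract (s_poly b) 1 = Fract (s_poly (q * b)) 1"
    by (simp add: s_poly_def)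
  then show ?thesis
    by (intro bernstein_sato_idealI[OF diff_ops.comp[OF diff_ops.mult[of "s_poly q"] D(1)]])
      (simp only: D(2))
qed

lemma bernstein_sato_poly_properties:
  assumes "bernstein_sato_ideal f \<noteq> {0}"
  shows "lead_coeff (bernstein_sato_poly f) = 1"
    and "bernstein_sato_ideal f = {q * bernstein_sato_poly f | q. True}"
proof -
  let ?I = "bernstein_sato_ideal f"
  have "\<exists>p. p \<in> ?I \<and> p \<noteq> 0" using assms bernstein_sato_ideal_0 by blast
  then obtain p where p: "p \<in> ?I" "p \<noteq> 0"
    and least: "\<And>r. r \<in> ?I \<Longrightarrow> r \<noteq> 0 \<Longrightarrow> degree p \<le> degree r"
  proof -
    assume *: "\<And>p. p \<in> ?I \<Longrightarrow> p \<noteq> 0 \<Longrightarrow>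
      (\<And>r. r \<in> ?I \<Longrightarrow> r \<noteq> 0 \<Longrightarrow> degree p \<le> degree r) \<Longrightarrow> thesis"
    from \<open>\<exists>p. p \<in> ?I \<and> p \<noteq> 0\<close> obtain p0 where "p0 \<in> ?I \<and> p0 \<noteq> 0" ..
    from arg_min_nat_lemma[of "\<lambda>p. p \<in> ?I \<and> p \<noteq> 0", OF this, of degree]
    show thesis by (intro *) blast+
  qed
  define b where "b = smult (inverse (lead_coeff p)) p"
  have b: "b \<in> ?I" "lead_coeff b = 1" "b \<noteq> 0" "degree b = degree p"
    using p bernstein_sato_ideal_mult[OF p(1), of "[:inverse (lead_coeff p):]"]
    by (simp_all add: b_def)
  have I: "?I = {q * b | q. True}"
  proof (intro equalityI subsetI)
    fix r assume r: "r \<in> ?I"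
    have "r mod b = r + (- (r div b)) * b" by (simp flip: minus_div_mult_eq_mod)
    then have "r mod b \<in> ?I"
      using bernstein_sato_ideal_add[OF r bernstein_sato_ideal_mult[OF b(1), of "- (r div b)"]]
      by (simp only:)
    then have "r mod b = 0"
      using least[of "r mod b"] degree_mod_less[of b r] b(3,4) by linarith
    then have "r = (r div b) * b" using div_mult_mod_eq[of r b] by simp
    then show "r \<in> {q * b | q. True}" by blast
  next
    fix r assume "r \<in> {q * b | q. True}"
    then show "r \<in> ?I" using bernstein_sato_ideal_mult[OF b(1)] by blast
  qed
  have "\<exists>!b. lead_coeff b = 1 \<and> ?I = {q * b | q. True}"
  proof (rule ex1I)
    show "lead_coeff b = 1 \<and> ?I = {q * b | q. True}" using b I by simp
    fix c assume c: "lead_coeff c = 1 \<and> ?I = {q * c | q. True}"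
    then have "1 * c \<in> ?I" by blast
    then obtain q where q: "c = q * b" using I by auto
    obtain q' where q': "b = q' * c" using b(1) c by blast
    have "c \<noteq> 0" using c by auto
    then have "degree c \<le> degree b"
      using q' b(3) by (metis dvd_triv_right dvd_imp_degree_le)
    moreover have "q \<noteq> 0" using q \<open>c \<noteq> 0\<close> by auto
    ultimately have "degree q = 0" using q b(3) by (simp add: degree_mult_eq)
    then obtain u where u: "q = [:u:]" by (metis degree_eq_zeroE)
    have "lead_coeff c = lead_coeff q * lead_coeff b" by (simp add: q lead_coeff_mult)
    then have "lead_coeff q = 1" using b(2) c by (metis mult.right_neutral)
    then have "u = 1" by (simp add: u)
    then show "c = b" by (simp add: q u)
  qed
  from theI'[OF this]
  show "lead_coeff (bernstein_sato_poly f) = 1"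
    and "?I = {q * bernstein_sato_poly f | q. True}"
    unfolding bernstein_sato_poly_def by blast+
qed


section \<open>Test functions and the Archimedean zeta function\<close>

fun ck_fun :: "nat \<Rightarrow> (real \<times> real \<Rightarrow> real) \<Rightarrow> bool" where
  "ck_fun 0 \<phi> \<longleftrightarrow> continuous_on UNIV \<phi>"
| "ck_fun (Suc k) \<phi> \<longleftrightarrow>
     (\<exists>\<phi>x \<phi>y. (\<forall>p. (\<phi> has_derivative (\<lambda>(u, v). \<phi>x p * u + \<phi>y p * v)) (at p)) \<and>
        ck_fun k \<phi>x \<and> ck_fun k \<phi>y)"

definition test_function :: "(real \<times> real \<Rightarrow> real) \<Rightarrow> bool" where
  "test_function \<phi> \<longleftrightarrow> (\<forall>k. ck_fun k \<phi>) \<and> compact (closure {p. \<phi> p \<noteq> 0})"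

definition arch_zeta :: "real poly poly \<Rightarrow> (real \<times> real \<Rightarrow> real) \<Rightarrow> complex \<Rightarrow> complex" where
  "arch_zeta f \<phi> s =
     (LINT p|lborel. complex_of_real \<bar>poly2 f (fst p) (snd p)\<bar> powr s * complex_of_real (\<phi> p))"

text \<open>Such an \<open>F\<close> is determined by \<open>f\<close> and \<open>\<phi>\<close> up to its values on a discrete set; in
  particular its poles, which are defined by the behaviour on punctured neighbourhoods, do not
  depend on the choice of \<open>F\<close>.\<close>

definition arch_zeta_continuation ::
  "real poly poly \<Rightarrow> (real \<times> real \<Rightarrow> real) \<Rightarrow> (complex \<Rightarrow> complex) \<Rightarrow> bool" where
  "arch_zeta_continuation f \<phi> F \<longleftrightarrow>
     F meromorphic_on {s. Re s > -1} \<and> (\<forall>s. Re s > 0 \<longrightarrow> F s = arch_zeta f \<phi> s)"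

end

theory Submission
  imports Defs
begin

text \<open>Put \<open>N(x, y) = x\<^sup>2\<^sup>b + y\<^sup>2\<^sup>a\<close>, which is weighted homogeneous of type \<open>(a, b; 2ab)\<close>. Subtract from
  \<open>\<phi>\<close> its Taylor polynomial of high order, cut off sharply to \<open>{N \<le> 1}\<close>. The integral of
  \<open>|f|\<^sup>s\<close> against the remainder is holomorphic on \<open>Re s > -1\<close>, and for a monomial the
  substitution \<open>y = |x|\<^bsup>b/a\<^esup> u\<close> makes the integral over \<open>{N \<le> 1}\<close> explicit: it equals
  \<open>a H\<^sub>j\<^sub>k(s) / (ms + (j + 1)a + (k + 1)b)\<close>, where
  \<open>H\<^sub>j\<^sub>k(s) = \<integral> (g\<^sub>+(u)\<^sup>s + (-1)\<^sup>j g\<^sub>-(u)\<^sup>s) u\<^sup>k (1 + u\<^sup>2\<^sup>a)\<^bsup>-((j + 1)a + (k + 1)b)/2ab\<^esup> du\<close> with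
  \<open>g\<^sub>\<plusminus>(u) = |f(\<plusminus>1, u)| (1 + u\<^sup>2\<^sup>a)\<^bsup>-m/2ab\<^esup>\<close> is again holomorphic on \<open>Re s > -1\<close>. So a pole in
  \<open>(-1, 0)\<close> can only come from a vanishing denominator, and there the weights cancel and
  \<open>H\<^sub>j\<^sub>k(s\<^sub>0)\<close> is the integral of condition (2). All convergence statements rest on one fact: an
  isolated singularity forces the gradient of \<open>f\<close> to be nonzero off the origin, so that \<open>f\<close> has
  only simple zeros along the fibres \<open>x = \<plusminus>1\<close> and vanishes to order at most one in \<open>x\<close> at
  infinity.\<close>

section \<open>Critical points of weighted homogeneous polynomials\<close>

text \<open>The cutoff of the Taylor polynomial is sharp so that the radial integral of a monomial
  is that of a pure power of \<open>x\<close>; the jump of the remainder along \<open>N = 1\<close>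
  is harmless, because only a pointwise bound by a power of \<open>N\<close> enters. The even
  exponents make \<open>N\<close> a polynomial vanishing only at 0, so a smooth cutoff can be built
  from \<open>N\<close> itself. One chart, \<open>x \<noteq> 0\<close>, covers the plane up to a
  null set, at the price of a noncompact fibre: \<open>u\<close> near infinity is the vicinity of
  the y-axis, where f may vanish, and the decay left there for \<open>-1 < \<sigma> < 0\<close> is
  \<open>|u| powr (-1 - a (1 + \<sigma>) / b)\<close>. Cancellation between different pairs (j, k)
  with the same candidate pole never has to be discussed: a pole is excluded as soon as every term
  has a limit, and it is produced by the test function \<open>x^j y^k\<close> times a cutoff, whose
  expansion has the single term (j, k). Condition (1) admits any continuation \<open>F\<close>, so
  the identity theorem is needed to pass to the explicit expansion.\<close>

lemma poly2_0 [simp]: "poly2 0 x y = 0"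
  by (simp add: poly2_def)

lemma poly2_pCons: "poly2 (pCons c p) x y = poly c x + y * poly2 p x y"
  by (simp add: poly2_def)

lemma poly2_add: "poly2 (p + q) x y = poly2 p x y + poly2 q x y"
  by (simp add: poly2_def)

lemma poly2_diff: "poly2 (p - q) x y = poly2 p x y - poly2 q x y"
  by (simp add: poly2_def)

lemma poly2_mult: "poly2 (p * q) x y = poly2 p x y * poly2 q x y"
  by (simp add: poly2_def)

lemma poly2_power: "poly2 (p ^ n) x y = poly2 p x y ^ n"
  by (simp add: poly2_def poly_power)

lemma poly2_sum: "poly2 (\<Sum>i\<in>I. p i) x y = (\<Sum>i\<in>I. poly2 (p i) x y)"
  by (simp add: poly2_def poly_sum)

lemma poly2_scale2: "poly2 (scale2 c p) x y = c * poly2 p x y"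
  by (simp add: poly2_def scale2_def)

lemma dX_pCons: "dX (pCons c p) = pCons (pderiv c) (dX p)"
  by (simp add: dX_def map_poly_pCons)

lemma dY_pCons: "dY (pCons c p) = p + pCons 0 (dY p)"
  by (simp add: dY_def pderiv_pCons)

text \<open>This links the formal \<open>dX\<close> and \<open>dY\<close> to analysis. One chain
  rule along curves serves the partial derivatives, Euler's identity and the fibres.\<close>

lemma poly2_has_field_derivative:
  fixes f :: "real poly poly"
  assumes X: "(X has_field_derivative X') (at t)" and Y: "(Y has_field_derivative Y') (at t)"
  shows "((\<lambda>t. poly2 f (X t) (Y t)) has_field_derivative
    poly2 (dX f) (X t) (Y t) * X' + poly2 (dY f) (X t) (Y t) * Y') (at t)"
proof (induction f)
  case 0
  then show ?case by (simp add: dX_def dY_def)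
next
  case (pCons c p)
  have "((\<lambda>t. poly c (X t) + Y t * poly2 p (X t) (Y t)) has_field_derivative
    poly (pderiv c) (X t) * X' + (Y' * poly2 p (X t) (Y t) +
      (poly2 (dX p) (X t) (Y t) * X' + poly2 (dY p) (X t) (Y t) * Y') * Y t)) (at t)"
    by (intro DERIV_add DERIV_mult Y pCons DERIV_chain2[OF poly_DERIV X])
  then show ?case
    by (simp add: poly2_pCons dX_pCons dY_pCons poly2_add algebra_simps)
qed

lemma continuous_on_poly2 [continuous_intros]:
  fixes f :: "real poly poly"
  assumes "continuous_on S g" "continuous_on S h"
  shows "continuous_on S (\<lambda>z. poly2 f (g z) (h z))"
  by (induction f) (auto simp: poly2_pCons intro!: continuous_intros assms)

lemma borel_measurable_poly2 [measurable]:
  fixes f :: "real poly poly"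
  assumes [measurable]: "g \<in> borel_measurable M" "h \<in> borel_measurable M"
  shows "(\<lambda>z. poly2 f (g z) (h z)) \<in> borel_measurable M"
proof -
  have "(\<lambda>p::real\<times>real. poly2 f (fst p) (snd p)) \<in> borel_measurable borel"
    by (intro borel_measurable_continuous_onI continuous_intros)
  then have "(\<lambda>z. poly2 f (fst (g z, h z)) (snd (g z, h z))) \<in> borel_measurable M"
    by (rule measurable_compose[rotated]) (simp add: borel_prod[symmetric])
  then show ?thesis by simp
qed

text \<open>Evaluating at a common zero of the partial derivatives factors through the Milnor algebra,
  and the powers of \<open>p\<close> are linearly dependent there.\<close>

lemma finite_image_critical_points:
  assumes "milnor_algebra_finite_dim f"
  shows "finite ((\<lambda>(x, y). poly2 p x y) ` {(x, y). poly2 (dX f) x y = 0 \<and> poly2 (dY f) x y = 0})"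
proof (rule ccontr)
  define S where "S = {(x, y). poly2 (dX f) x y = 0 \<and> poly2 (dY f) x y = 0}"
  define E where "E = (\<lambda>(x, y). poly2 p x y) ` S"
  assume "infinite ((\<lambda>(x, y). poly2 p x y) ` {(x, y). poly2 (dX f) x y = 0 \<and> poly2 (dY f) x y = 0})"
  then have inf: "infinite E" by (simp add: E_def S_def)
  obtain B where B: "finite B" "milnor_algebra f = (\<lambda>p. jacobian_cong f `` {p}) ` scale2.span B"
    using assms unfolding milnor_algebra_finite_dim_def by blast
  have "\<exists>r\<in>scale2.span B. \<forall>(x, y)\<in>S. poly2 r x y = poly2 p x y ^ i" for i
  proof -
    have "jacobian_cong f `` {p ^ i} \<in> milnor_algebra f"
      by (auto simp: milnor_algebra_def quotient_def)
    then obtain r where r: "r \<in> scale2.span B" "jacobian_cong f `` {p ^ i} = jacobian_cong f `` {r}"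
      using B by auto
    then have "(p ^ i, r) \<in> jacobian_cong f"
      using eq_equiv_class[OF _ equiv_jacobian_cong] by blast
    then obtain g h where gh: "p ^ i - r = g * dX f + h * dY f"
      by (auto simp: jacobian_cong_def jacobian_ideal_def)
    have "poly2 r x y = poly2 p x y ^ i" if "(x, y) \<in> S" for x y
      using arg_cong[OF gh, of "\<lambda>q. poly2 q x y"] that
      by (simp add: S_def poly2_diff poly2_add poly2_mult poly2_power)
    then show ?thesis using r(1) by blast
  qed
  then have "\<forall>i. \<exists>r. r \<in> scale2.span B \<and> (\<forall>(x, y)\<in>S. poly2 r x y = poly2 p x y ^ i)"
    by blast
  from choice[OF this] obtain r where
    "\<forall>i. r i \<in> scale2.span B \<and> (\<forall>(x, y)\<in>S. poly2 (r i) x y = poly2 p x y ^ i)" ..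
  then have r: "\<And>i. r i \<in> scale2.span B"
    "\<And>i x y. (x, y) \<in> S \<Longrightarrow> poly2 (r i) x y = poly2 p x y ^ i"
    by auto
  have zero: "q = 0" if q: "\<And>z. z \<in> E \<Longrightarrow> poly q z = 0" for q :: "real poly"
  proof (rule ccontr)
    assume "q \<noteq> 0"
    then have "finite {z. poly q z = 0}" by (rule poly_roots_finite)
    then show False using inf q by (meson finite_subset mem_Collect_eq subsetI)
  qed
  \<comment> \<open>Independence concerns the set \<open>range r\<close>; injectivity lets sums over
    it be read as sums over exponents and makes the set infinite.\<close>
  have inj: "inj r"
  proof (rule injI)
    fix i j assume "r i = r j"
    then have "poly (monom 1 i - monom 1 j) z = 0" if "z \<in> E" for z
      using r(2)[of _ _ i] r(2)[of _ _ j] that by (auto simp: E_def poly_monom)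
    then have "monom 1 i - monom (1::real) j = 0" by (rule zero)
    then have "coeff (monom 1 i) i = coeff (monom (1::real) j) i" by simp
    then show "i = j" by (auto split: if_splits)
  qed
  have ind: "scale2.independent (range r)"
  proof
    assume "scale2.dependent (range r)"
    then obtain U u where U: "finite U" "U \<subseteq> range r" "(\<Sum>v\<in>U. scale2 (u v) v) = 0" "\<exists>v\<in>U. u v \<noteq> 0"
      unfolding scale2.dependent_explicit by blast
    define I where "I = r -` U"
    have I: "finite I" "U = r ` I"
      using U inj by (auto simp: I_def finite_vimageI)
    have sum0: "(\<Sum>i\<in>I. scale2 (u (r i)) (r i)) = 0"
      using U(3) inj by (simp add: I(2) sum.reindex inj_on_def)
    have "poly (\<Sum>i\<in>I. monom (u (r i)) i) z = 0" if "z \<in> E" for z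
    proof -
      obtain x y where xy: "(x, y) \<in> S" "z = poly2 p x y"
        using \<open>z \<in> E\<close> by (auto simp: E_def)
      show ?thesis
        using arg_cong[OF sum0, of "\<lambda>q. poly2 q x y"] xy r(2)[OF xy(1)]
        by (simp add: poly2_sum poly2_scale2 poly_sum poly_monom)
    qed
    then have "(\<Sum>i\<in>I. monom (u (r i)) i) = 0" by (rule zero)
    then have "coeff (\<Sum>i\<in>I. monom (u (r i)) i) k = 0" for k by (simp only: coeff_0)
    then have ite: "(if k \<in> I then u (r k) else 0) = 0" for k
      using I(1) by (simp add: coeff_sum)
    have "u (r k) = 0" if "k \<in> I" for k
      using ite[of k] that by simp
    then show False using U(4) I by auto
  qed
  have "finite (range r)"
    using scale2.independent_span_bound[OF B(1) ind] r(1) by blast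
  then show False using inj finite_imageD infinite_UNIV_nat by blast
qed

lemma weighted_homogeneousD:
  "weighted_homogeneous a b m f \<Longrightarrow> poly2 f (c ^ a * x) (c ^ b * y) = c ^ m * poly2 f x y"
  by (simp add: weighted_homogeneous_def)

text \<open>Differentiate the homogeneity relation in \<open>x\<close>. The factor
  \<open>c ^ a\<close> stays on the left, since the expected exponent \<open>m - a\<close> would be
  truncated for \<open>a > m\<close>.\<close>

lemma weighted_homogeneous_dX:
  assumes "weighted_homogeneous a b m f"
  shows "c ^ a * poly2 (dX f) (c ^ a * x) (c ^ b * y) = c ^ m * poly2 (dX f) x y"
proof -
  have "((\<lambda>x. poly2 f (c ^ a * x) (c ^ b * y)) has_field_derivative
     poly2 (dX f) (c ^ a * x) (c ^ b * y) * c ^ a + poly2 (dY f) (c ^ a * x) (c ^ b * y) * 0) (at x)"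
    by (intro poly2_has_field_derivative) (auto intro!: derivative_eq_intros)
  moreover have "((\<lambda>x. c ^ m * poly2 f x y) has_field_derivative
     c ^ m * (poly2 (dX f) x y * 1 + poly2 (dY f) x y * 0)) (at x)"
    by (intro DERIV_cmult poly2_has_field_derivative) (auto intro!: derivative_eq_intros)
  ultimately show ?thesis
    using DERIV_unique by (fastforce simp: weighted_homogeneousD[OF assms])
qed

lemma weighted_homogeneous_dY:
  assumes "weighted_homogeneous a b m f"
  shows "c ^ b * poly2 (dY f) (c ^ a * x) (c ^ b * y) = c ^ m * poly2 (dY f) x y"
proof -
  have "((\<lambda>y. poly2 f (c ^ a * x) (c ^ b * y)) has_field_derivative
     poly2 (dX f) (c ^ a * x) (c ^ b * y) * 0 + poly2 (dY f) (c ^ a * x) (c ^ b * y) * c ^ b) (at y)"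
    by (intro poly2_has_field_derivative) (auto intro!: derivative_eq_intros)
  moreover have "((\<lambda>y. c ^ m * poly2 f x y) has_field_derivative
     c ^ m * (poly2 (dX f) x y * 0 + poly2 (dY f) x y * 1)) (at y)"
    by (intro DERIV_cmult poly2_has_field_derivative) (auto intro!: derivative_eq_intros)
  ultimately show ?thesis
    using DERIV_unique by (fastforce simp: weighted_homogeneousD[OF assms])
qed

text \<open>Differentiate the homogeneity relation in the scaling parameter at
  \<open>c = 1\<close>.\<close>

lemma euler_identity:
  assumes "weighted_homogeneous a b m f"
  shows "real a * x * poly2 (dX f) x y + real b * y * poly2 (dY f) x y = real m * poly2 f x y"
proof -
  have "((\<lambda>c. poly2 f (c ^ a * x) (c ^ b * y)) has_field_derivative
     poly2 (dX f) (1 ^ a * x) (1 ^ b * y) * (real a * x) +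
     poly2 (dY f) (1 ^ a * x) (1 ^ b * y) * (real b * y)) (at 1)"
    by (intro poly2_has_field_derivative) (auto intro!: derivative_eq_intros)
  moreover have "((\<lambda>c. c ^ m * poly2 f x y) has_field_derivative (real m * poly2 f x y)) (at 1)"
    by (auto intro!: derivative_eq_intros)
  ultimately show ?thesis
    using DERIV_unique by (fastforce simp: weighted_homogeneousD[OF assms])
qed

text \<open>The critical set is invariant under the weighted scaling, so a critical point off the
  origin brings a whole orbit, along which some coordinate takes infinitely many values; finite
  dimension of the Milnor algebra permits only finitely many.\<close>

lemma gradient_nonzero:
  assumes "a > 0" "b > 0"
    and wh: "weighted_homogeneous a b m f" and fin: "milnor_algebra_finite_dim f"
    and xy: "(x, y) \<noteq> (0, 0)"
  shows "poly2 (dX f) x y \<noteq> 0 \<or> poly2 (dY f) x y \<noteq> 0"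
proof (rule ccontr)
  define S where "S = {(x, y). poly2 (dX f) x y = 0 \<and> poly2 (dY f) x y = 0}"
  assume "\<not> ?thesis"
  then have S: "(c ^ a * x, c ^ b * y) \<in> S" if "c > 0" for c
    using weighted_homogeneous_dX[OF wh, of c x y] weighted_homogeneous_dY[OF wh, of c x y] that
    by (auto simp: S_def)
  have inf: "infinite ((\<lambda>c. c ^ n * z) ` {0<..})" if "n > 0" "z \<noteq> 0" for n and z :: real
  proof -
    have "inj_on (\<lambda>c. c ^ n * z) {0<..}"
      using that by (auto intro!: inj_onI simp: power_eq_iff_eq_base)
    then show ?thesis by (simp add: finite_image_iff infinite_Ioi)
  qed
  consider "x \<noteq> 0" | "y \<noteq> 0" using xy by auto
  then show False
  proof cases
    case 1
    \<comment> \<open>The polynomial \<open>[:[:0, 1:]:]\<close> is the coordinate x; in the other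
      case \<open>[:0, 1:]\<close> is y.\<close>
    have "(\<lambda>c. c ^ a * x) ` {0<..} \<subseteq> (\<lambda>(x, y). poly2 [:[:0, 1:]:] x y) ` S"
      using S by (force simp: poly2_def)
    then show False
      using finite_image_critical_points[OF fin, of "[:[:0, 1:]:]"] inf[OF \<open>a > 0\<close> 1]
      unfolding S_def by (meson finite_subset)
  next
    case 2
    have "(\<lambda>c. c ^ b * y) ` {0<..} \<subseteq> (\<lambda>(x, y). poly2 [:0, 1:] x y) ` S"
      using S by (force simp: poly2_def)
    then show False
      using finite_image_critical_points[OF fin, of "[:0, 1:]"] inf[OF \<open>b > 0\<close> 2]
      unfolding S_def by (meson finite_subset)
  qed
qed

section \<open>Holomorphic dependence on the exponent\<close>

lemma norm_exp_partial_sum_le: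
  fixes x :: "'a::{real_normed_field,banach}"
  shows "norm (\<Sum>i<n. x ^ i / fact i) \<le> exp (norm x)"
proof -
  have "norm (\<Sum>i<n. x ^ i / fact i) \<le> (\<Sum>i<n. norm x ^ i / fact i)"
    by (rule order_trans[OF norm_sum]) (simp add: norm_divide norm_power)
  also have "\<dots> \<le> exp (norm x)"
    unfolding exp_def using summable_exp_generic[of "norm x"]
    by (intro order_trans[OF _ sum_le_suminf[of _ "{..<n}"]]) (auto simp: divide_inverse mult.commute)
  finally show ?thesis .
qed

lemma power_div_fact_le_exp:
  fixes x :: real assumes "x \<ge> 0" shows "x ^ n / fact n \<le> exp x"
proof -
  have "x ^ n / fact n \<le> (\<Sum>i<Suc n. x ^ i / fact i)"
    using assms by (simp add: sum_nonneg)
  also have "\<dots> \<le> norm (\<Sum>i<Suc n. x ^ i / fact i)"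
    by simp
  also have "\<dots> \<le> exp x"
    using norm_exp_partial_sum_le[of x "Suc n"] assms by simp
  finally show ?thesis .
qed

text \<open>Trades powers of the logarithm for two neighbouring real exponents:
  \<open>exp (r * |ln g|)\<close> is either \<open>g powr r\<close> or
  \<open>g powr (-r)\<close>.\<close>

lemma exp_abs_ln_le:
  fixes g :: real assumes "g > 0" "r \<ge> 0"
  shows "g powr \<sigma> * exp (r * \<bar>ln g\<bar>) \<le> g powr (\<sigma> + r) + g powr (\<sigma> - r)"
proof (cases "ln g \<ge> 0")
  case True
  then show ?thesis using assms by (simp add: powr_def exp_add[symmetric] algebra_simps)
next
  case False
  then show ?thesis using assms by (simp add: powr_def exp_add[symmetric] algebra_simps)
qed

text \<open>The exponential series of \<open>g powr s\<close> around \<open>s0\<close> has partial sums dominated by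
  \<open>g powr (\<sigma> + r) + g powr (\<sigma> - r)\<close>, so it may be integrated termwise.\<close>

lemma holomorphic_on_integral_powr:
  fixes g \<psi> :: "'a \<Rightarrow> real"
  assumes [measurable]: "g \<in> borel_measurable M" "\<psi> \<in> borel_measurable M"
    and nonneg: "\<And>z. g z \<ge> 0"
    and int: "\<And>\<sigma>. A < \<sigma> \<Longrightarrow> integrable M (\<lambda>z. g z powr \<sigma> * \<psi> z)"
  shows "(\<lambda>s. LINT z|M. complex_of_real (g z) powr s * complex_of_real (\<psi> z)) holomorphic_on {s. Re s > A}"
    (is "?F holomorphic_on _")
proof -
  have "?F analytic_on {s0}" if s0: "Re s0 > A" for s0
  proof -
    \<comment> \<open>Half the distance to the abscissa \<open>A\<close>, so that
      \<open>\<sigma> - r\<close> and \<open>\<sigma> + r\<close> are still admissible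
      exponents.\<close>
    define \<sigma> r where "\<sigma> = Re s0" and "r = (\<sigma> - A) / 2"
    have r: "r > 0" "A < \<sigma> - r" "A < \<sigma> + r" using s0 by (auto simp: \<sigma>_def r_def field_simps)
    define D where "D = (\<lambda>z. (g z powr (\<sigma> + r) + g z powr (\<sigma> - r)) * \<bar>\<psi> z\<bar>)"
    have "integrable M (\<lambda>z. \<bar>g z powr (\<sigma> + r) * \<psi> z\<bar> + \<bar>g z powr (\<sigma> - r) * \<psi> z\<bar>)"
      by (intro Bochner_Integration.integrable_add integrable_abs int r)
    then have D: "integrable M D"
      by (simp add: D_def abs_mult algebra_simps)
    \<comment> \<open>The \<open>n\<close>-th Taylor coefficient at \<open>s0\<close> of the
      integrand as a function of the exponent.\<close>
    define T where "T = (\<lambda>n z. complex_of_real (g z) powr s0 * of_real (ln (g z)) ^ n / fact n * complex_of_real (\<psi> z))"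
    define a where "a = (\<lambda>n. LINT z|M. T n z)"
    \<comment> \<open>At \<open>g z = 0\<close> the convention \<open>0 powr s = 0\<close> makes
      both sides 0, whatever the exponent.\<close>
    have normg: "cmod (complex_of_real (g z) powr s0) = g z powr \<sigma>" for z
      using nonneg[of z] by (cases "g z = 0") (auto simp: norm_powr_real_powr \<sigma>_def)
    have bound: "g z powr \<sigma> * exp (r * \<bar>ln (g z)\<bar>) * \<bar>\<psi> z\<bar> \<le> D z" for z
      using exp_abs_ln_le[of "g z" r \<sigma>] nonneg[of z] r
      by (cases "g z = 0") (auto simp: D_def intro!: mult_right_mono)
    have intT: "integrable M (T n)" for n
    proof (rule Bochner_Integration.integrable_bound)
      show "integrable M (\<lambda>z. inverse (r ^ n) * D z)" using D by simp
      show "T n \<in> borel_measurable M" unfolding T_def by measurable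
      show "AE z in M. norm (T n z) \<le> norm (inverse (r ^ n) * D z)"
      proof (rule AE_I2)
        fix z
        have "r ^ n * norm (T n z) = g z powr \<sigma> * ((r * \<bar>ln (g z)\<bar>) ^ n / fact n) * \<bar>\<psi> z\<bar>"
          by (simp add: T_def norm_mult norm_divide norm_power normg power_mult_distrib)
        also have "\<dots> \<le> g z powr \<sigma> * exp (r * \<bar>ln (g z)\<bar>) * \<bar>\<psi> z\<bar>"
          using r by (intro mult_right_mono mult_left_mono power_div_fact_le_exp) auto
        also have "\<dots> \<le> D z" by (rule bound)
        finally have "norm (T n z) \<le> inverse (r ^ n) * D z"
          using r by (simp add: field_simps)
        then show "norm (T n z) \<le> norm (inverse (r ^ n) * D z)" by simp
      qed
    qed
    have "?F holomorphic_on ball s0 r"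
    proof (rule power_series_holomorphic[where a = a])
      fix w assume w: "w \<in> ball s0 r"
      define S where "S = (\<lambda>n z. \<Sum>i<n. T i z * (w - s0) ^ i)"
      have S_eq: "S n z = complex_of_real (g z) powr s0 * (\<Sum>i<n. ((w - s0) * of_real (ln (g z))) ^ i / fact i)
          * complex_of_real (\<psi> z)" for n z
        by (simp add: S_def T_def sum_distrib_left sum_distrib_right power_mult_distrib mult_ac)
      have "(\<lambda>n. LINT z|M. S n z) \<longlonglongrightarrow> ?F w"
      proof (rule integral_dominated_convergence[where w = D])
        show "AE z in M. (\<lambda>n. S n z) \<longlonglongrightarrow> complex_of_real (g z) powr w * complex_of_real (\<psi> z)"
        proof (rule AE_I2)
          fix z
          show "(\<lambda>n. S n z) \<longlonglongrightarrow> complex_of_real (g z) powr w * complex_of_real (\<psi> z)"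
          proof (cases "g z = 0")
            case False
            then have g: "g z > 0" using nonneg[of z] by simp
            have "(\<lambda>i. ((w - s0) * of_real (ln (g z))) ^ i / fact i) sums exp ((w - s0) * of_real (ln (g z)))"
              using exp_converges[of "(w - s0) * of_real (ln (g z))"]
              by (simp add: scaleR_conv_of_real divide_inverse mult.commute)
            then have "(\<lambda>n. S n z) \<longlonglongrightarrow> complex_of_real (g z) powr s0 * exp ((w - s0) * of_real (ln (g z)))
                * complex_of_real (\<psi> z)"
              unfolding S_eq sums_def by (intro tendsto_intros)
            also have "complex_of_real (g z) powr s0 * exp ((w - s0) * of_real (ln (g z))) = complex_of_real (g z) powr w"
              using g by (simp add: powr_def Ln_of_real exp_add[symmetric] algebra_simps)
            finally show ?thesis .
          qed (simp add: S_eq)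
        qed
        show "AE z in M. norm (S n z) \<le> D z" for n
        proof (rule AE_I2)
          fix z
          have "norm (S n z) \<le> g z powr \<sigma> * exp (norm ((w - s0) * of_real (ln (g z)))) * \<bar>\<psi> z\<bar>"
            unfolding S_eq norm_mult normg
            using norm_exp_partial_sum_le[of "(w - s0) * complex_of_real (ln (g z))" n]
            by (intro mult_mono) (auto simp: norm_mult)
          also have "\<dots> \<le> g z powr \<sigma> * exp (r * \<bar>ln (g z)\<bar>) * \<bar>\<psi> z\<bar>"
            using w by (intro mult_mono) (auto simp: norm_mult dist_norm norm_minus_commute intro!: mult_right_mono)
          also have "\<dots> \<le> D z" by (rule bound)
          finally show "norm (S n z) \<le> D z" .
        qed
        show "S n \<in> borel_measurable M" for n unfolding S_def T_def by measurable
      qed (use D in measurable)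
      also have "(\<lambda>n. LINT z|M. S n z) = (\<lambda>n. \<Sum>i<n. a i * (w - s0) ^ i)"
        unfolding S_def a_def using intT by (subst Bochner_Integration.integral_sum) auto
      finally show "(\<lambda>n. a n * (w - s0) ^ n) sums ?F w" by (simp add: sums_def)
    qed
    then show ?thesis using r(1) by (auto simp: analytic_at_ball)
  qed
  then have "?F analytic_on {s. Re s > A}"
    by (subst analytic_on_analytic_at) auto
  then show ?thesis by (rule analytic_imp_holomorphic)
qed

section \<open>Integrals of powers along the fibres\<close>

lemma set_integrable_powr_from_0:
  fixes \<sigma> d :: real assumes "\<sigma> > -1" "d \<ge> 0"
  shows "set_integrable lborel {0..d} (\<lambda>u. u powr \<sigma>)"
    and "(LINT u:{0..d}|lborel. u powr \<sigma>) = d powr (\<sigma> + 1) / (\<sigma> + 1)"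
proof -
  have *: "((\<lambda>u. u powr \<sigma>) has_integral (d powr (\<sigma> + 1) / (\<sigma> + 1))) {0..d}"
    using assms by (intro has_integral_powr_from_0) auto
  then have "(\<lambda>u. u powr \<sigma>) absolutely_integrable_on {0..d}"
    by (intro nonnegative_absolutely_integrable_1) (auto simp: has_integral_integrable)
  then show int: "set_integrable lborel {0..d} (\<lambda>u. u powr \<sigma>)"
    unfolding set_integrable_def by (subst (asm) integrable_completion) auto
  show "(LINT u:{0..d}|lborel. u powr \<sigma>) = d powr (\<sigma> + 1) / (\<sigma> + 1)"
    using set_borel_integral_eq_integral(2)[OF int] * by (simp add: integral_unique)
qed

lemma set_integrable_abs_powr:
  fixes \<sigma> c d :: real assumes "\<sigma> > -1" "d \<ge> 0"
  shows "set_integrable lborel {c - d..c + d} (\<lambda>u. \<bar>u - c\<bar> powr \<sigma>)"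
proof -
  have 0: "integrable lborel (\<lambda>u. indicator {0..d} u * u powr \<sigma>)" (is "integrable _ ?h")
    using set_integrable_powr_from_0(1)[OF assms] by (simp add: set_integrable_def)
  have 1: "integrable lborel (\<lambda>u. ?h (- c + 1 * u))"
    using lborel_integrable_real_affine[OF 0, of 1 "- c"] by simp
  have 2: "integrable lborel (\<lambda>u. ?h (c + (- 1) * u))"
    using lborel_integrable_real_affine[OF 0, of "- 1" c] by simp
  show ?thesis unfolding set_integrable_def
  proof (rule Bochner_Integration.integrable_bound[OF Bochner_Integration.integrable_add[OF 1 2]])
    show "AE u in lborel. norm (indicator {c - d..c + d} u *\<^sub>R \<bar>u - c\<bar> powr \<sigma>)
        \<le> norm (?h (- c + 1 * u) + ?h (c + (- 1) * u))"
      by (rule AE_I2) (auto simp: indicator_def)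
  qed measurable
qed

lemma set_integrable_powr_atLeast:
  fixes \<delta> M :: real assumes "\<delta> > 0" "M > 0"
  shows "set_integrable lborel {M..} (\<lambda>u. \<bar>u\<bar> powr (- 1 - \<delta>))"
proof -
  have "((\<lambda>u. u powr (- 1 - \<delta>)) has_integral (- (M powr ((- 1 - \<delta>) + 1)) / ((- 1 - \<delta>) + 1))) {M..}"
    using assms by (intro has_integral_powr_to_inf) auto
  then have "(\<lambda>u. u powr (- 1 - \<delta>)) absolutely_integrable_on {M..}"
    by (intro nonnegative_absolutely_integrable_1) (auto simp: has_integral_integrable)
  then have "set_integrable lborel {M..} (\<lambda>u. u powr (- 1 - \<delta>))"
    unfolding set_integrable_def by (subst (asm) integrable_completion) auto
  then show ?thesis
    by (rule set_integrable_cong[THEN iffD1, rotated -1]) (use assms in auto)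
qed

lemma set_integrable_powr_atMost:
  fixes \<delta> M :: real assumes "\<delta> > 0" "M > 0"
  shows "set_integrable lborel {..-M} (\<lambda>u. \<bar>u\<bar> powr (- 1 - \<delta>))"
proof -
  have "integrable lborel (\<lambda>u. indicator {M..} (0 + (- 1) * u) *\<^sub>R \<bar>0 + (- 1) * u\<bar> powr (- 1 - \<delta>))"
    using lborel_integrable_real_affine[OF set_integrable_powr_atLeast[OF assms, unfolded set_integrable_def], of "- 1" 0]
    by simp
  then show ?thesis unfolding set_integrable_def
    by (rule Bochner_Integration.integrable_cong[THEN iffD1, rotated -1]) (auto simp: indicator_def)
qed

lemma borel_measurable_poly [measurable]: "poly (p :: real poly) \<in> borel_measurable borel"
  by (intro borel_measurable_continuous_onI continuous_intros)

text \<open>Near each point \<open>G\<close> is either nonzero or a linear factor times a nonzero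
  polynomial, and \<open>|u - c| powr \<sigma>\<close> is integrable for
  \<open>\<sigma> > -1\<close>; compactness glues the local intervals.\<close>

lemma set_integrable_poly_powr:
  fixes G :: "real poly"
  assumes "\<sigma> > -1" and simple: "\<And>u. poly G u = 0 \<Longrightarrow> poly (pderiv G) u \<noteq> 0"
  shows "set_integrable lborel {-M..M} (\<lambda>u. \<bar>poly G u\<bar> powr \<sigma>)"
proof -
  have local: "\<exists>d>0. set_integrable lborel {c - d..c + d} (\<lambda>u. \<bar>poly G u\<bar> powr \<sigma>)" for c
  proof -
    have bnd: "\<exists>d>0. \<forall>u\<in>{c - d..c + d}. \<bar>poly Q u\<bar> powr \<sigma> \<le> \<bar>poly Q c\<bar> powr \<sigma> + 1"
      if "poly Q c \<noteq> 0" for Q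
    proof -
      have "((\<lambda>u. \<bar>poly Q u\<bar> powr \<sigma>) \<longlongrightarrow> \<bar>poly Q c\<bar> powr \<sigma>) (nhds c)"
        unfolding tendsto_nhds_iff using that
        by (intro conjI refl tendsto_powr tendsto_rabs tendsto_const poly_isCont[unfolded isCont_def]) auto
      then have "\<forall>\<^sub>F u in nhds c. \<bar>poly Q u\<bar> powr \<sigma> < \<bar>poly Q c\<bar> powr \<sigma> + 1"
        by (rule order_tendstoD) simp
      then obtain e where "e > 0" "\<And>u. dist u c < e \<Longrightarrow> \<bar>poly Q u\<bar> powr \<sigma> < \<bar>poly Q c\<bar> powr \<sigma> + 1"
        by (auto simp: eventually_nhds_metric)
      moreover from this(1) have "dist u c < e" if "u \<in> {c - e / 2..c + e / 2}" for u
        using that unfolding dist_real_def atLeastAtMost_iff by arith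
      ultimately show ?thesis
        by (intro exI[of _ "e / 2"]) (auto intro: less_imp_le)
    qed
    have "\<exists>Q. poly Q c \<noteq> 0 \<and> (G = Q \<or> G = [:- c, 1:] * Q)"
    proof (cases "poly G c = 0")
      case True
      then obtain Q where Q: "G = [:- c, 1:] * Q" by (meson dvdE poly_eq_0_iff_dvd)
      then have "poly (pderiv G) c = poly Q c"
        by (simp add: pderiv_mult pderiv_pCons del: mult_pCons_left)
      then have "poly Q c \<noteq> 0" using simple[OF True] by simp
      with Q show ?thesis by blast
    qed blast
    then obtain Q where Q: "poly Q c \<noteq> 0" "G = Q \<or> G = [:- c, 1:] * Q" by blast
    from bnd[OF Q(1)] obtain d where d: "d > 0"
      "\<And>u. u \<in> {c - d..c + d} \<Longrightarrow> \<bar>poly Q u\<bar> powr \<sigma> \<le> \<bar>poly Q c\<bar> powr \<sigma> + 1" by blast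
    define C where "C = \<bar>poly Q c\<bar> powr \<sigma> + 1"
    have "C > 0" by (simp add: C_def add_nonneg_pos)
    \<comment> \<open>One majorant for both cases: the constant covers a nonzero value of
      \<open>G\<close> at \<open>c\<close>, the power covers a simple zero.\<close>
    have "set_integrable lborel {c - d..c + d} (\<lambda>u. C * \<bar>u - c\<bar> powr \<sigma> + C)"
    proof (intro set_integral_add(1))
      show "set_integrable lborel {c - d..c + d} (\<lambda>u. C * \<bar>u - c\<bar> powr \<sigma>)"
        using set_integrable_abs_powr[OF assms(1), of d c] d(1) by simp
      show "set_integrable lborel {c - d..c + d} (\<lambda>u. C)"
        by (intro borel_integrable_atLeastAtMost' continuous_intros)
    qed
    then have "set_integrable lborel {c - d..c + d} (\<lambda>u. \<bar>poly G u\<bar> powr \<sigma>)"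
      unfolding set_integrable_def
    proof (rule Bochner_Integration.integrable_bound)
      show "AE u in lborel. norm (indicat_real {c - d..c + d} u *\<^sub>R \<bar>poly G u\<bar> powr \<sigma>)
          \<le> norm (indicat_real {c - d..c + d} u *\<^sub>R (C * \<bar>u - c\<bar> powr \<sigma> + C))"
      proof (rule AE_I2)
        fix u
        have "\<bar>poly G u\<bar> powr \<sigma> \<le> C * \<bar>u - c\<bar> powr \<sigma> + C" if u: "u \<in> {c - d..c + d}"
          using Q(2)
        proof
          assume "G = Q"
          then show ?thesis using d(2)[OF u] \<open>C > 0\<close> by (auto simp: C_def intro: add_nonneg_nonneg order_trans)
        next
          assume "G = [:- c, 1:] * Q"
          then have "poly G u = (u - c) * poly Q u" by (simp add: left_diff_distrib)
          then have "\<bar>poly G u\<bar> powr \<sigma> = \<bar>poly Q u\<bar> powr \<sigma> * \<bar>u - c\<bar> powr \<sigma>"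
            by (simp only: abs_mult powr_mult abs_ge_zero mult.commute)
          also have "\<dots> \<le> C * \<bar>u - c\<bar> powr \<sigma>"
            using d(2)[OF u] by (intro mult_right_mono) (auto simp: C_def)
          finally show ?thesis using \<open>C > 0\<close> by simp
        qed
        then show "norm (indicat_real {c - d..c + d} u *\<^sub>R \<bar>poly G u\<bar> powr \<sigma>)
            \<le> norm (indicat_real {c - d..c + d} u *\<^sub>R (C * \<bar>u - c\<bar> powr \<sigma> + C))"
          by (auto simp: indicator_def)
      qed
    qed measurable
    with d(1) show ?thesis by blast
  qed
  then have "\<forall>c. \<exists>d. d > 0 \<and> set_integrable lborel {c - d..c + d} (\<lambda>u. \<bar>poly G u\<bar> powr \<sigma>)"
    by blast
  from choice[OF this] obtain d where
    "\<forall>c. d c > 0 \<and> set_integrable lborel {c - d c..c + d c} (\<lambda>u. \<bar>poly G u\<bar> powr \<sigma>)" ..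
  then have d: "d c > 0" "set_integrable lborel {c - d c..c + d c} (\<lambda>u. \<bar>poly G u\<bar> powr \<sigma>)" for c
    by simp_all
  \<comment> \<open>Compactness needs the open intervals, while integrability is known on the closed
    ones.\<close>
  have cover: "{-M..M} \<subseteq> (\<Union>c\<in>{-M..M}. {c - d c<..<c + d c})"
  proof
    fix x assume "x \<in> {-M..M}"
    moreover have "x \<in> {x - d x<..<x + d x}" using d(1)[of x] by simp
    ultimately show "x \<in> (\<Union>c\<in>{-M..M}. {c - d c<..<c + d c})" by (rule UN_I)
  qed
  obtain I where I: "I \<subseteq> {-M..M}" "finite I" "{-M..M} \<subseteq> (\<Union>c\<in>I. {c - d c<..<c + d c})"
    by (rule compactE_image[OF compact_Icc _ cover]) simp_all
  have int: "set_integrable lborel (\<Union>c\<in>I. {c - d c..c + d c}) (\<lambda>u. \<bar>poly G u\<bar> powr \<sigma>)"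
    by (rule set_integrable_UN[OF I(2) d(2)]) simp
  have sub: "{-M..M} \<subseteq> (\<Union>c\<in>I. {c - d c..c + d c})"
    by (rule order_trans[OF I(3)]) (rule UN_mono, simp_all add: greaterThanLessThan_subseteq_atLeastAtMost_iff)
  show ?thesis
    by (rule set_integrable_subset[OF int _ sub]) simp
qed

text \<open>With \<open>h\<close> a slice of f across the y-axis, \<open>nz\<close> is what the
  gradient condition supplies. If \<open>h 0\<close> is nonzero, the linear bound follows from a
  constant one because \<open>|x| < 1\<close>; otherwise the difference quotient tends to
  \<open>D\<close>.\<close>

lemma abs_ge_linear_near_0:
  fixes h :: "real \<Rightarrow> real"
  assumes der: "(h has_field_derivative D) (at 0)" and nz: "h 0 \<noteq> 0 \<or> D \<noteq> 0"
  shows "\<exists>k>0. \<exists>e>0. \<forall>x. 0 < \<bar>x\<bar> \<and> \<bar>x\<bar> < e \<longrightarrow> k * \<bar>x\<bar> \<le> \<bar>h x\<bar>"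
proof -
  have *: "\<exists>e>0. \<forall>x. 0 < \<bar>x\<bar> \<and> \<bar>x\<bar> < e \<longrightarrow> P x" if "\<forall>\<^sub>F x in at 0. P x" for P :: "real \<Rightarrow> bool"
    using that by (auto simp: eventually_at dist_real_def)
  show ?thesis
  proof (cases "h 0 = 0")
    case True
    have "((\<lambda>x. \<bar>h x / x\<bar>) \<longlongrightarrow> \<bar>D\<bar>) (at 0)"
      using der True by (intro tendsto_rabs) (simp add: has_field_derivative_def DERIV_def[unfolded has_field_derivative_def])
    then have "\<forall>\<^sub>F x in at 0. \<bar>h x / x\<bar> > \<bar>D\<bar> / 2"
      by (rule order_tendstoD) (use nz True in auto)
    then have "\<forall>\<^sub>F x in at 0. \<bar>D\<bar> / 2 * \<bar>x\<bar> \<le> \<bar>h x\<bar>"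
      using eventually_at_ball'[of 1 0 UNIV, OF zero_less_one]
      by eventually_elim (auto simp: abs_divide field_simps)
    from *[OF this] show ?thesis
      using nz True by (intro exI[of _ "\<bar>D\<bar> / 2"]) auto
  next
    case False
    have "((\<lambda>x. \<bar>h x\<bar>) \<longlongrightarrow> \<bar>h 0\<bar>) (at 0)"
      using DERIV_isCont[OF der] by (intro tendsto_rabs) (simp add: isCont_def)
    then have "\<forall>\<^sub>F x in at 0. \<bar>h x\<bar> > \<bar>h 0\<bar> / 2"
      by (rule order_tendstoD) (use False in auto)
    then have "\<forall>\<^sub>F x in at 0. \<bar>h 0\<bar> / 2 * \<bar>x\<bar> \<le> \<bar>h x\<bar>"
      using eventually_at_ball'[of 1 0 UNIV, OF zero_less_one]
    proof eventually_elim
      case (elim x)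
      then have "\<bar>h 0\<bar> / 2 * \<bar>x\<bar> \<le> \<bar>h 0\<bar> / 2 * 1"
        by (intro mult_left_mono) (auto simp: dist_real_def)
      then show ?case using elim by simp
    qed
    from *[OF this] show ?thesis
      using False by (intro exI[of _ "\<bar>h 0\<bar> / 2"]) auto
  qed
qed

lemma poly2_as_poly: "\<exists>G::real poly. \<forall>u. poly G u = poly2 f x u"
proof (induction f)
  case (pCons c p)
  then obtain G where "\<And>u. poly G u = poly2 p x u" by blast
  then show ?case by (intro exI[of _ "pCons (poly c x) G"]) (simp add: poly2_pCons)
qed (auto intro: exI[of _ 0])

section \<open>Growth of f along the fibres and integrability of its powers\<close>

locale weighted_homogeneous_isolated =
  fixes a b m :: nat and f :: "real poly poly"
  assumes a_pos: "a > 0" and b_pos: "b > 0" and m_pos: "m > 0"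
    and homogeneous: "weighted_homogeneous a b m f"
    and milnor: "milnor_algebra_finite_dim f"
begin

text \<open>If \<open>f\<close> and \<open>f_y\<close> both vanished, Euler's identity would leave
  \<open>a x f_x = 0\<close>, hence a critical point off the origin.\<close>

lemma partial_y_nonzero:
  assumes "x \<noteq> 0" "poly2 f x y = 0"
  shows "poly2 (dY f) x y \<noteq> 0"
  using gradient_nonzero[OF a_pos b_pos homogeneous milnor, of x y]
    euler_identity[OF homogeneous, of x y] assms a_pos by auto

text \<open>On \<open>x = 0\<close> Euler's identity reads \<open>b y f_y = m f\<close>, so a zero
  of f already has \<open>f_y = 0\<close> there.\<close>

lemma partial_x_nonzero:
  assumes "y \<noteq> 0" "poly2 f 0 y = 0"
  shows "poly2 (dX f) 0 y \<noteq> 0"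
  using gradient_nonzero[OF a_pos b_pos homogeneous milnor, of 0 y]
    euler_identity[OF homogeneous, of 0 y] assms b_pos by auto

lemma set_integrable_fibre:
  fixes x \<sigma> :: real
  assumes "x \<noteq> 0" "\<sigma> > -1"
  shows "set_integrable lborel {-M..M} (\<lambda>u. \<bar>poly2 f x u\<bar> powr \<sigma>)"
proof -
  obtain G where G: "\<And>u. poly G u = poly2 f x u" using poly2_as_poly by blast
  have "poly (pderiv G) u = poly2 (dY f) x u" for u
  proof (rule DERIV_unique)
    show "(poly G has_field_derivative poly (pderiv G) u) (at u)" by (rule poly_DERIV)
    have "((\<lambda>u. poly2 f x u) has_field_derivative poly2 (dX f) x u * 0 + poly2 (dY f) x u * 1) (at u)"
      by (intro poly2_has_field_derivative) auto
    then show "(poly G has_field_derivative poly2 (dY f) x u) (at u)"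
      using ext[of "poly G" "poly2 f x", OF G] by simp
  qed
  then have "set_integrable lborel {-M..M} (\<lambda>u. \<bar>poly G u\<bar> powr \<sigma>)"
    using partial_y_nonzero assms by (intro set_integrable_poly_powr) (auto simp: G)
  then show ?thesis by (simp add: G)
qed

text \<open>Scaling by \<open>c = |u| powr (-1/b)\<close> normalises the second coordinate to its
  sign: large \<open>u\<close> on a fibre corresponds to points near the y-axis.\<close>

lemma fibre_at_infinity:
  assumes "u \<noteq> 0"
  shows "poly2 f x u = \<bar>u\<bar> powr (m / b) * poly2 f (\<bar>u\<bar> powr (- (a / b)) * x) (sgn u)"
proof -
  define c where "c = \<bar>u\<bar> powr (- (1 / b))"
  have c: "c ^ n = \<bar>u\<bar> powr (- (n / b))" for n
    using assms by (simp add: c_def powr_realpow[symmetric] powr_powr)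
  have "\<bar>u\<bar> powr (m / b) * poly2 f (c ^ a * x) (c ^ b * u)
      = \<bar>u\<bar> powr (m / b) * c ^ m * poly2 f x u"
    by (simp add: weighted_homogeneousD[OF homogeneous])
  also have "\<bar>u\<bar> powr (m / b) * c ^ m = 1"
    using assms by (simp add: c powr_add[symmetric])
  finally show ?thesis
    using assms b_pos by (simp add: c powr_minus sgn_real_def abs_real_def split: if_splits)
qed

text \<open>After this normalisation the points with \<open>|u| \<ge> 1\<close> lie in a fixed
  compact box.\<close>

lemma fibre_upper_bound:
  "\<exists>C>0. \<forall>u. \<bar>u\<bar> \<ge> 1 \<longrightarrow> \<bar>poly2 f x u\<bar> \<le> C * \<bar>u\<bar> powr (m / b)"
proof -
  have "compact ((\<lambda>p. poly2 f (fst p) (snd p)) ` ({-\<bar>x\<bar>..\<bar>x\<bar>} \<times> {-1..1}))"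
    by (intro compact_continuous_image continuous_intros compact_Times) auto
  then have "bounded ((\<lambda>p. poly2 f (fst p) (snd p)) ` ({-\<bar>x\<bar>..\<bar>x\<bar>} \<times> {-1..1}))"
    by (rule compact_imp_bounded)
  then obtain C where C: "C > 0" "\<And>p. p \<in> {-\<bar>x\<bar>..\<bar>x\<bar>} \<times> {-1..1} \<Longrightarrow> \<bar>poly2 f (fst p) (snd p)\<bar> \<le> C"
    unfolding bounded_pos real_norm_def by blast
  have "\<bar>poly2 f x u\<bar> \<le> C * \<bar>u\<bar> powr (m / b)" if u: "\<bar>u\<bar> \<ge> 1" for u
  proof -
    have "\<bar>u\<bar> powr (- (a / b)) * \<bar>x\<bar> \<le> 1 * \<bar>x\<bar>"
      using u by (intro mult_right_mono) (auto simp: powr_minus intro!: inverse_le_1_iff[THEN iffD2] ge_one_powr_ge_zero)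
    then have "\<bar>\<bar>u\<bar> powr (- (a / b)) * x\<bar> \<le> \<bar>x\<bar>"
      by (simp add: abs_mult)
    then have "(\<bar>u\<bar> powr (- (a / b)) * x, sgn u) \<in> {-\<bar>x\<bar>..\<bar>x\<bar>} \<times> {-1..1}"
      by (auto simp: sgn_real_def)
    then have "\<bar>poly2 f (\<bar>u\<bar> powr (- (a / b)) * x) (sgn u)\<bar> \<le> C"
      using C(2) by fastforce
    then show ?thesis
      using u by (subst fibre_at_infinity) (auto simp: abs_mult mult.commute[of C] intro!: mult_left_mono)
  qed
  with C(1) show ?thesis by blast
qed

text \<open>Near the y-axis \<open>|f|\<close> is at least a multiple of the first coordinate, which
  is \<open>|u| powr (-a/b)\<close> in absolute value after normalisation; this lowers the exponent
  from \<open>m/b\<close> to \<open>(m - a)/b\<close>.\<close>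

lemma fibre_lower_bound:
  assumes "\<bar>x\<bar> = 1"
  shows "\<exists>k>0. \<exists>M\<ge>1. \<forall>u. \<bar>u\<bar> \<ge> M \<longrightarrow> k * \<bar>u\<bar> powr ((real m - a) / b) \<le> \<bar>poly2 f x u\<bar>"
proof -
  have ex: "\<exists>k>0. \<exists>e>0. \<forall>x. 0 < \<bar>x\<bar> \<and> \<bar>x\<bar> < e \<longrightarrow> k * \<bar>x\<bar> \<le> \<bar>poly2 f x y\<bar>" if "y \<noteq> 0" for y
  proof (rule abs_ge_linear_near_0)
    show "((\<lambda>x. poly2 f x y) has_field_derivative poly2 (dX f) 0 y * 1 + poly2 (dY f) 0 y * 0) (at 0)"
      by (intro poly2_has_field_derivative) auto
    show "poly2 f 0 y \<noteq> 0 \<or> poly2 (dX f) 0 y * 1 + poly2 (dY f) 0 y * 0 \<noteq> 0"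
      using partial_x_nonzero[OF that] by auto
  qed
  obtain k1 e1 where 1: "k1 > 0" "e1 > 0" "\<And>x. 0 < \<bar>x\<bar> \<Longrightarrow> \<bar>x\<bar> < e1 \<Longrightarrow> k1 * \<bar>x\<bar> \<le> \<bar>poly2 f x 1\<bar>"
    using ex[of 1] by auto
  obtain k2 e2 where 2: "k2 > 0" "e2 > 0" "\<And>x. 0 < \<bar>x\<bar> \<Longrightarrow> \<bar>x\<bar> < e2 \<Longrightarrow> k2 * \<bar>x\<bar> \<le> \<bar>poly2 f x (- 1)\<bar>"
    using ex[of "-1"] by auto
  define k where "k = min k1 k2"
  define e where "e = min e1 e2"
  have ke: "k > 0" "e > 0" using 1 2 by (auto simp: k_def e_def)
  have low: "k * \<bar>x\<bar> \<le> \<bar>poly2 f x y\<bar>" if "0 < \<bar>x\<bar>" "\<bar>x\<bar> < e" "y = 1 \<or> y = - 1" for x y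
    using that(3)
  proof
    assume "y = 1"
    have "k * \<bar>x\<bar> \<le> k1 * \<bar>x\<bar>" by (intro mult_right_mono) (auto simp: k_def)
    also have "\<dots> \<le> \<bar>poly2 f x y\<bar>" using 1(3)[of x] that \<open>y = 1\<close> by (auto simp: e_def)
    finally show ?thesis .
  next
    assume "y = - 1"
    have "k * \<bar>x\<bar> \<le> k2 * \<bar>x\<bar>" by (intro mult_right_mono) (auto simp: k_def)
    also have "\<dots> \<le> \<bar>poly2 f x y\<bar>" using 2(3)[of x] that \<open>y = - 1\<close> by (auto simp: e_def)
    finally show ?thesis .
  qed
  have "((\<lambda>u. u powr (- (real a / real b))) \<longlongrightarrow> 0) at_top"
    using a_pos b_pos by (intro tendsto_neg_powr filterlim_ident) auto
  then have "\<forall>\<^sub>F u in at_top. u powr (- (real a / real b)) < e"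
    by (rule order_tendstoD) (use ke in auto)
  then obtain M where M: "\<And>u. u \<ge> M \<Longrightarrow> u powr (- (real a / real b)) < e"
    by (auto simp: eventually_at_top_linorder)
  have "k * \<bar>u\<bar> powr ((real m - a) / b) \<le> \<bar>poly2 f x u\<bar>" if u: "\<bar>u\<bar> \<ge> max 1 M" for u
  proof -
    have "\<bar>u\<bar> powr ((real m - a) / b) = \<bar>u\<bar> powr (m / b) * \<bar>u\<bar> powr (- (a / b))"
      by (simp add: powr_add[symmetric] diff_divide_distrib)
    then have "k * \<bar>u\<bar> powr ((real m - a) / b) = \<bar>u\<bar> powr (m / b) * (k * \<bar>\<bar>u\<bar> powr (- (a / b)) * x\<bar>)"
      using assms by (simp add: abs_mult)
    also have "\<dots> \<le> \<bar>u\<bar> powr (m / b) * \<bar>poly2 f (\<bar>u\<bar> powr (- (a / b)) * x) (sgn u)\<bar>"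
      using M[of "\<bar>u\<bar>"] u assms
      by (intro mult_left_mono low) (auto simp: abs_mult sgn_real_def)
    also have "\<dots> = \<bar>poly2 f x u\<bar>"
      using u by (subst (2) fibre_at_infinity) (auto simp: abs_mult)
    finally show ?thesis .
  qed
  then show ?thesis using ke(1) by (intro exI[of _ k] conjI exI[of _ "max 1 M"]) auto
qed

text \<open>\<open>W u\<close> is \<open>x^2b + u^2a\<close> on the fibres \<open>x = 1\<close> and
  \<open>x = -1\<close>, that is, the restriction of the function \<open>N\<close> below.\<close>

definition W :: "real \<Rightarrow> real" where "W u = 1 + u ^ (2 * a)"

lemma W_ge_1: "W u \<ge> 1"
  by (simp add: W_def)

lemma W_pos [simp]: "W u > 0"
  using W_ge_1[of u] by linarith

lemma borel_measurable_W [measurable]: "W \<in> borel_measurable borel"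
  unfolding W_def[abs_def] by measurable

text \<open>For \<open>|u| \<ge> 1\<close> the value \<open>W u\<close> lies between
  \<open>|u|^2a\<close> and twice that; the maximum serves both signs of \<open>q\<close>.\<close>

lemma W_powr_le:
  fixes u q :: real
  assumes "\<bar>u\<bar> \<ge> 1"
  shows "W u powr q \<le> max 1 (2 powr q) * \<bar>u\<bar> powr (2 * a * q)"
proof -
  have "u ^ (2 * a) = \<bar>u\<bar> powr (2 * a)"
    using assms powr_realpow[of "\<bar>u\<bar>" "2 * a"] by (simp add: power_even_abs)
  then have P: "(u ^ (2 * a)) powr q = \<bar>u\<bar> powr (2 * a * q)"
    by (simp add: powr_powr)
  have ge1: "u ^ (2 * a) \<ge> 1"
    using one_le_power[OF assms, of "2 * a"] by (simp add: power_even_abs)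
  show ?thesis
  proof (cases "q \<ge> 0")
    case True
    have "W u powr q \<le> (2 * u ^ (2 * a)) powr q"
      using True ge1 by (intro powr_mono2) (auto simp: W_def)
    also have "\<dots> = 2 powr q * \<bar>u\<bar> powr (2 * a * q)"
      by (simp add: powr_mult P)
    finally show ?thesis
      by (rule order_trans) (rule mult_right_mono, auto)
  next
    case False
    have "W u powr q \<le> (u ^ (2 * a)) powr q"
      using False ge1 by (intro powr_mono2') (auto simp: W_def)
    also have "\<dots> = 1 * \<bar>u\<bar> powr (2 * a * q)"
      by (simp add: P)
    finally show ?thesis
      by (rule order_trans) (rule mult_right_mono, auto)
  qed
qed

text \<open>The power of \<open>W\<close> is what the radial integration will leave behind; it
  behaves like \<open>|u| powr (-(m \<sigma> + a + b)/b)\<close>. For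
  \<open>\<sigma> \<ge> 0\<close> the upper bound of f leaves the exponent \<open>-1 - a/b\<close>.
  For \<open>\<sigma> < 0\<close> the lower bound must be used and costs
  \<open>a |\<sigma>| / b\<close>, leaving \<open>-1 - a (1 + \<sigma>)/b\<close>, still below
  -1.\<close>

lemma integrable_fibre:
  fixes x \<sigma> :: real
  assumes x: "\<bar>x\<bar> = 1" and \<sigma>: "\<sigma> > -1"
  shows "integrable lborel (\<lambda>u. \<bar>poly2 f x u\<bar> powr \<sigma> * W u powr (- ((m * \<sigma> + a + b) / (2 * a * b))))"
    (is "integrable _ ?h")
proof -
  define q where "q = - ((m * \<sigma> + a + b) / (2 * a * b))"
  have "\<exists>d>0. \<exists>C\<ge>0. \<exists>M\<ge>1. \<forall>u. \<bar>u\<bar> \<ge> M \<longrightarrow> ?h u \<le> C * \<bar>u\<bar> powr (- 1 - d)"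
  proof (cases "\<sigma> \<ge> 0")
    case True
    obtain C where C: "C > 0" "\<And>u. \<bar>u\<bar> \<ge> 1 \<Longrightarrow> \<bar>poly2 f x u\<bar> \<le> C * \<bar>u\<bar> powr (m / b)"
      using fibre_upper_bound by blast
    have "?h u \<le> (C powr \<sigma> * max 1 (2 powr q)) * \<bar>u\<bar> powr (- 1 - a / b)" if "\<bar>u\<bar> \<ge> 1" for u
    proof -
      have "\<bar>poly2 f x u\<bar> powr \<sigma> \<le> (C * \<bar>u\<bar> powr (m / b)) powr \<sigma>"
        using C(2)[OF that] True by (intro powr_mono2) auto
      also have "\<dots> = C powr \<sigma> * \<bar>u\<bar> powr (m / b * \<sigma>)"
        using C(1) by (simp add: powr_mult powr_powr)
      finally have "?h u \<le> (C powr \<sigma> * \<bar>u\<bar> powr (m / b * \<sigma>)) * (max 1 (2 powr q) * \<bar>u\<bar> powr (2 * a * q))"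
        using W_powr_le[OF that, of q] unfolding q_def[symmetric] by (intro mult_mono) auto
      also have "\<dots> = (C powr \<sigma> * max 1 (2 powr q)) * \<bar>u\<bar> powr (m / b * \<sigma> + 2 * a * q)"
        by (simp add: powr_add)
      also have "m / b * \<sigma> + 2 * a * q = - 1 - a / b"
        using a_pos b_pos by (simp add: q_def field_simps)
      finally show ?thesis .
    qed
    then show ?thesis
      using a_pos b_pos by (intro exI[of _ "a / b"] conjI exI[of _ "C powr \<sigma> * max 1 (2 powr q)"] exI[of _ 1]) auto
  next
    case False
    obtain k M where k: "k > 0" "M \<ge> 1" "\<And>u. \<bar>u\<bar> \<ge> M \<Longrightarrow> k * \<bar>u\<bar> powr ((real m - a) / b) \<le> \<bar>poly2 f x u\<bar>"
      using fibre_lower_bound[OF x] by blast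
    define d where "d = a * (1 + \<sigma>) / b"
    have "?h u \<le> (k powr \<sigma> * max 1 (2 powr q)) * \<bar>u\<bar> powr (- 1 - d)" if "\<bar>u\<bar> \<ge> M" for u
    proof -
      have "\<bar>poly2 f x u\<bar> powr \<sigma> \<le> (k * \<bar>u\<bar> powr ((real m - a) / b)) powr \<sigma>"
        using k(3)[OF that] False k that by (intro powr_mono2') auto
      also have "\<dots> = k powr \<sigma> * \<bar>u\<bar> powr ((real m - a) / b * \<sigma>)"
        using k(1) by (simp add: powr_mult powr_powr)
      finally have "?h u \<le> (k powr \<sigma> * \<bar>u\<bar> powr ((real m - a) / b * \<sigma>)) * (max 1 (2 powr q) * \<bar>u\<bar> powr (2 * a * q))"
        using W_powr_le[of u q] that k(2) unfolding q_def[symmetric] by (intro mult_mono) auto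
      also have "\<dots> = (k powr \<sigma> * max 1 (2 powr q)) * \<bar>u\<bar> powr ((real m - a) / b * \<sigma> + 2 * a * q)"
        by (simp add: powr_add)
      also have "(real m - a) / b * \<sigma> + 2 * a * q = - 1 - d"
        using a_pos b_pos by (simp add: q_def d_def field_simps)
      finally show ?thesis .
    qed
    moreover have "d > 0" using a_pos b_pos \<sigma> by (simp add: d_def)
    ultimately show ?thesis
      using k(2) by (intro exI[of _ d] conjI exI[of _ "k powr \<sigma> * max 1 (2 powr q)"] exI[of _ M]) auto
  qed
  then obtain d C M where d: "d > 0" "C \<ge> 0" "M \<ge> 1" "\<And>u. \<bar>u\<bar> \<ge> M \<Longrightarrow> ?h u \<le> C * \<bar>u\<bar> powr (- 1 - d)" by blast
  define D where "D = max 1 ((W M) powr q)"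
  have WM: "W u powr q \<le> D" if "\<bar>u\<bar> \<le> M" for u
  proof (cases "q \<ge> 0")
    case True
    have "u ^ (2 * a) \<le> M ^ (2 * a)"
      using power_mono[OF that, of "2 * a"] by (simp add: power_even_abs)
    then have "W u powr q \<le> W M powr q" using True W_ge_1[of u] by (intro powr_mono2) (auto simp: W_def)
    then show ?thesis by (simp add: D_def)
  next
    case False
    then have "W u powr q \<le> 1 powr q" using W_ge_1[of u] by (intro powr_mono2') auto
    then show ?thesis by (simp add: D_def)
  qed
  have 1: "integrable lborel (\<lambda>u. D * (indicator {-M..M} u * \<bar>poly2 f x u\<bar> powr \<sigma>))"
    using set_integrable_fibre[of x \<sigma> M] x \<sigma> by (intro integrable_mult_right) (auto simp: set_integrable_def)
  have 2: "integrable lborel (\<lambda>u. C * (indicator {M..} u * \<bar>u\<bar> powr (- 1 - d)))"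
    using set_integrable_powr_atLeast[of d M] d by (intro integrable_mult_right) (auto simp: set_integrable_def)
  have 3: "integrable lborel (\<lambda>u. C * (indicator {..-M} u * \<bar>u\<bar> powr (- 1 - d)))"
    using set_integrable_powr_atMost[of d M] d by (intro integrable_mult_right) (auto simp: set_integrable_def)
  show ?thesis
  proof (rule Bochner_Integration.integrable_bound[OF Bochner_Integration.integrable_add[OF 1
          Bochner_Integration.integrable_add[OF 2 3]]])
    show "AE u in lborel. norm (?h u) \<le> norm (D * (indicator {-M..M} u * \<bar>poly2 f x u\<bar> powr \<sigma>) +
        (C * (indicator {M..} u * \<bar>u\<bar> powr (- 1 - d)) + C * (indicator {..-M} u * \<bar>u\<bar> powr (- 1 - d))))"
      (is "AE u in lborel. _ \<le> norm (?A u + (?B u + ?C u))")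
    proof (rule AE_I2)
      fix u
      have nonneg: "?A u \<ge> 0" "?B u \<ge> 0" "?C u \<ge> 0"
        using d(2) by (auto simp: D_def)
      have "?h u \<le> ?A u + (?B u + ?C u)"
      proof (cases "\<bar>u\<bar> \<le> M")
        case True
        then have "?h u \<le> ?A u"
          using mult_left_mono[OF WM[OF True], of "\<bar>poly2 f x u\<bar> powr \<sigma>"]
          by (simp add: indicator_def q_def mult.commute abs_le_iff minus_le_iff)
        then show ?thesis using nonneg by linarith
      next
        case False
        then have "?h u \<le> C * \<bar>u\<bar> powr (- 1 - d)" by (intro d(4)) simp
        moreover have "C * \<bar>u\<bar> powr (- 1 - d) \<in> {?B u, ?C u}"
          using False by (auto simp: indicator_def)
        ultimately show ?thesis using nonneg by auto
      qed
      then show "norm (?h u) \<le> norm (?A u + (?B u + ?C u))" by simp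
    qed
  qed measurable
qed

end

section \<open>The weighted substitution\<close>

text \<open>The argument is \<open>(u, x)\<close>: with the fibre coordinate first, Fubini's inner
  integral runs over \<open>x\<close>. The Jacobian is \<open>|x| powr \<alpha>\<close>.\<close>

definition shear :: "real \<Rightarrow> real \<times> real \<Rightarrow> real \<times> real" where
  "shear \<alpha> z = (snd z, \<bar>snd z\<bar> powr \<alpha> * fst z)"

lemma measurable_shear [measurable]: "shear \<alpha> \<in> borel \<rightarrow>\<^sub>M borel"
  unfolding shear_def[abs_def] borel_prod[symmetric] by measurable

text \<open>For fixed \<open>x \<noteq> 0\<close> the map is linear in \<open>u\<close> with factor
  \<open>|x| powr \<alpha>\<close>, so the one-dimensional affine substitution under Tonelli
  suffices; \<open>x = 0\<close> is a null set.\<close>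

lemma distr_shear:
  "distr (density lborel (\<lambda>z. ennreal (\<bar>snd z\<bar> powr \<alpha>))) borel (shear \<alpha>) = (lborel :: (real \<times> real) measure)"
proof (rule measure_eqI)
  fix A :: "(real \<times> real) set"
  assume "A \<in> sets (distr (density lborel (\<lambda>z. ennreal (\<bar>snd z\<bar> powr \<alpha>))) borel (shear \<alpha>))"
  then have A [measurable]: "A \<in> sets borel" by simp
  have [measurable]: "(\<lambda>y. indicator A (x, y) :: ennreal) \<in> borel_measurable borel" for x
    using A unfolding borel_prod[symmetric] by measurable
  have i: "(\<lambda>z. indicator A (shear \<alpha> z) :: ennreal) \<in> borel_measurable borel"
    by (rule measurable_compose[OF measurable_shear borel_measurable_indicator[OF A]])
  have p: "(\<lambda>z. ennreal (\<bar>snd z\<bar> powr \<alpha>)) \<in> borel_measurable (borel :: (real \<times> real) measure)"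
    unfolding borel_prod[symmetric] by measurable
  have m: "(\<lambda>z. ennreal (\<bar>snd z\<bar> powr \<alpha>) * indicator A (shear \<alpha> z)) \<in> borel_measurable (lborel \<Otimes>\<^sub>M lborel)"
    using i p by (simp add: lborel_prod)
  have "emeasure (distr (density lborel (\<lambda>z. ennreal (\<bar>snd z\<bar> powr \<alpha>))) borel (shear \<alpha>)) A
      = (\<integral>\<^sup>+z. indicator A z \<partial>distr (density lborel (\<lambda>z. ennreal (\<bar>snd z\<bar> powr \<alpha>))) borel (shear \<alpha>))"
    by simp
  also have "\<dots> = (\<integral>\<^sup>+z. ennreal (\<bar>snd z\<bar> powr \<alpha>) * indicator A (shear \<alpha> z) \<partial>lborel)"
    using i p by (simp add: nn_integral_distr nn_integral_density del: nn_integral_indicator)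
  also have "\<dots> = (\<integral>\<^sup>+x. \<integral>\<^sup>+u. ennreal (\<bar>x\<bar> powr \<alpha>) * indicator A (x, \<bar>x\<bar> powr \<alpha> * u) \<partial>lborel \<partial>lborel)"
    using lborel_pair.nn_integral_snd[OF m] by (simp add: lborel_prod shear_def)
  also have "\<dots> = (\<integral>\<^sup>+x. \<integral>\<^sup>+y. indicator A (x, y) \<partial>lborel \<partial>lborel)"
  proof (rule nn_integral_cong_AE)
    show "AE x in lborel. (\<integral>\<^sup>+u. ennreal (\<bar>x\<bar> powr \<alpha>) * indicator A (x, \<bar>x\<bar> powr \<alpha> * u) \<partial>lborel)
        = (\<integral>\<^sup>+y. indicator A (x, y) \<partial>lborel)"
      using AE_lborel_singleton[of 0]
    proof eventually_elim
      case (elim x)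
      then have "\<bar>x\<bar> powr \<alpha> \<noteq> 0" by simp
      from nn_integral_real_affine[OF _ this, of "\<lambda>y. indicator A (x, y)" 0] show ?case
        by (simp add: nn_integral_cmult)
    qed
  qed
  also have "\<dots> = emeasure lborel A"
  proof -
    have "(\<lambda>z. indicator A z :: ennreal) \<in> borel_measurable (lborel \<Otimes>\<^sub>M lborel)"
      using A by (simp add: lborel_prod)
    from lborel.nn_integral_fst[OF this] show ?thesis by (simp add: lborel_prod)
  qed
  finally show "emeasure (distr (density lborel (\<lambda>z. ennreal (\<bar>snd z\<bar> powr \<alpha>))) borel (shear \<alpha>)) A
      = emeasure lborel A" .
qed simp

lemma
  fixes h :: "real \<times> real \<Rightarrow> 'b::{banach, second_countable_topology}"
  assumes [measurable]: "h \<in> borel_measurable borel"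
  shows integrable_shear_iff:
      "integrable lborel h \<longleftrightarrow> integrable lborel (\<lambda>z. \<bar>snd z\<bar> powr \<alpha> *\<^sub>R h (shear \<alpha> z))"
    and integral_shear:
      "(LINT z|lborel. h z) = (LINT z|lborel. \<bar>snd z\<bar> powr \<alpha> *\<^sub>R h (shear \<alpha> z))"
proof -
  let ?D = "density lborel (\<lambda>z :: real \<times> real. ennreal (\<bar>snd z\<bar> powr \<alpha>))"
  have "(\<lambda>z. \<bar>snd z\<bar> powr \<alpha>) \<in> borel_measurable (borel :: (real \<times> real) measure)"
    unfolding borel_prod[symmetric] by measurable
  then have p: "(\<lambda>z. \<bar>snd z\<bar> powr \<alpha>) \<in> borel_measurable (lborel :: (real \<times> real) measure)"
    by simp
  have sh: "shear \<alpha> \<in> ?D \<rightarrow>\<^sub>M borel" by simp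
  have hs: "(\<lambda>z. h (shear \<alpha> z)) \<in> borel_measurable lborel"
    using measurable_compose[OF measurable_shear assms] by simp
  have "integrable lborel h \<longleftrightarrow> integrable (distr ?D borel (shear \<alpha>)) h"
    by (simp only: distr_shear)
  also have "\<dots> \<longleftrightarrow> integrable ?D (\<lambda>z. h (shear \<alpha> z))"
    by (rule integrable_distr_eq[OF sh assms])
  also have "\<dots> \<longleftrightarrow> integrable lborel (\<lambda>z. \<bar>snd z\<bar> powr \<alpha> *\<^sub>R h (shear \<alpha> z))"
    by (rule integrable_density[OF hs p]) simp
  finally show "integrable lborel h \<longleftrightarrow> integrable lborel (\<lambda>z. \<bar>snd z\<bar> powr \<alpha> *\<^sub>R h (shear \<alpha> z))" .
  have "(LINT z|lborel. h z) = (LINT z|distr ?D borel (shear \<alpha>). h z)"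
    by (simp only: distr_shear)
  also have "\<dots> = (LINT z|?D. h (shear \<alpha> z))"
    by (rule integral_distr[OF sh assms])
  also have "\<dots> = (LINT z|lborel. \<bar>snd z\<bar> powr \<alpha> *\<^sub>R h (shear \<alpha> z))"
    by (rule integral_density[OF hs p]) simp
  finally show "(LINT z|lborel. h z) = (LINT z|lborel. \<bar>snd z\<bar> powr \<alpha> *\<^sub>R h (shear \<alpha> z))" .
qed

text \<open>Reflection handles the negative half-line. \<open>A\<close> and \<open>B\<close> are
  meant for the data on the fibres \<open>x = 1\<close> and \<open>x = -1\<close>; a single value at
  0 is immaterial.\<close>

lemma has_bochner_integral_two_sided:
  fixes g :: "real \<Rightarrow> 'b::{real_normed_field, banach, second_countable_topology}"
  assumes I: "has_bochner_integral lborel (\<lambda>x. indicator {0..X} x *\<^sub>R g x) I"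
    and h: "\<And>x. x > 0 \<Longrightarrow> x \<le> X \<Longrightarrow> h x = A * g x" "\<And>x. x < 0 \<Longrightarrow> - x \<le> X \<Longrightarrow> h x = B * g (- x)"
      "\<And>x. \<bar>x\<bar> > X \<Longrightarrow> h x = 0" and meas: "h \<in> borel_measurable borel"
  shows "has_bochner_integral lborel h ((A + B) * I)"
proof -
  have 1: "has_bochner_integral lborel (\<lambda>x. A * (indicator {0..X} x *\<^sub>R g x)) (A * I)"
    using I by (intro has_bochner_integral_mult_right)
  have I': "has_bochner_integral lborel (\<lambda>x. indicator {0..X} (- x) *\<^sub>R g (- x)) I"
    using lborel_has_bochner_integral_real_affine_iff[THEN iffD1, of "-1" "\<lambda>x. indicator {0..X} x *\<^sub>R g x" I 0] I
    by simp
  have 2: "has_bochner_integral lborel (\<lambda>x. B * (indicator {0..X} (- x) *\<^sub>R g (- x))) (B * I)"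
    using I' by (intro has_bochner_integral_mult_right)
  have sum: "has_bochner_integral lborel
      (\<lambda>x. A * (indicator {0..X} x *\<^sub>R g x) + B * (indicator {0..X} (- x) *\<^sub>R g (- x))) (A * I + B * I)"
    by (rule has_bochner_integral_add[OF 1 2])
  have eq: "AE x in lborel. A * (indicator {0..X} x *\<^sub>R g x) + B * (indicator {0..X} (- x) *\<^sub>R g (- x)) = h x"
    using AE_lborel_singleton[of 0]
  proof eventually_elim
    case (elim x)
    then show ?case
      using h(1)[of x] h(2)[of x] h(3)[of x] by (cases "x > 0"; cases "\<bar>x\<bar> \<le> X") (auto simp: indicator_def)
  qed
  have meas': "h \<in> borel_measurable lborel" using meas by simp
  show ?thesis
    using has_bochner_integral_cong_AE[THEN iffD1, OF borel_measurable_has_bochner_integral[OF sum] meas' eq sum]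
    by (simp only: distrib_right)
qed

lemma has_bochner_integral_real_powr:
  fixes p X :: real assumes "p > -1" "X \<ge> 0"
  shows "has_bochner_integral lborel (\<lambda>x. indicator {0..X} x *\<^sub>R x powr p) (X powr (p + 1) / (p + 1))"
  using set_integrable_powr_from_0[OF assms]
  by (simp add: has_bochner_integral_iff set_integrable_def set_lebesgue_integral_def)

lemma has_bochner_integral_complex_powr:
  fixes p :: complex assumes p: "Re p > -1" and X: "X \<ge> 0"
  shows "has_bochner_integral lborel (\<lambda>x. indicator {0..X} x *\<^sub>R complex_of_real x powr p)
    (complex_of_real X powr (p + 1) / (p + 1))"
proof -
  have "p + 1 \<noteq> 0" using p by (auto simp: complex_eq_iff)
  have int: "set_integrable lborel {0..X} (\<lambda>x. complex_of_real x powr p)"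
    unfolding set_integrable_def
  proof (rule Bochner_Integration.integrable_bound)
    show "integrable lborel (\<lambda>x. indicator {0..X} x *\<^sub>R x powr Re p)"
      using set_integrable_powr_from_0(1)[OF p X] by (simp add: set_integrable_def)
  qed (auto simp: indicator_def norm_powr_real_powr intro!: AE_I2)
  have "((\<lambda>x. complex_of_real x powr p) has_integral
      complex_of_real X powr (p + 1) / (p + 1) - complex_of_real 0 powr (p + 1) / (p + 1)) {0..X}"
  proof (rule fundamental_theorem_of_calculus_interior[OF X])
    \<comment> \<open>For \<open>Re p < 0\<close> the primitive has no derivative at 0; continuity
      there, from \<open>Re (p + 1) > 0\<close>, is enough.\<close>
    have cont: "continuous (at x within {0..X}) (\<lambda>x. complex_of_real x powr (p + 1))" if "x \<in> {0..X}" for x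
    proof (cases "x = 0")
      case True
      have "((\<lambda>x. complex_of_real x powr (p + 1)) \<longlongrightarrow> 0) (at 0 within {0..X})"
        using p by (intro tendsto_powr_complex_0[of _ _ _ "p + 1"] tendsto_const)
          (auto intro!: tendsto_eq_intros)
      then show ?thesis using True by (simp add: continuous_within)
    next
      case False
      then have "complex_of_real x \<notin> \<real>\<^sub>\<le>\<^sub>0" using that by (auto simp: complex_nonpos_Reals_iff)
      then show ?thesis
        unfolding continuous_within by (intro tendsto_powr_complex) (auto intro!: tendsto_intros)
    qed
    show "continuous_on {0..X} (\<lambda>x. complex_of_real x powr (p + 1) / (p + 1))"
      unfolding continuous_on_eq_continuous_within
      using cont \<open>p + 1 \<noteq> 0\<close> by (auto intro!: continuous_divide continuous_const)
    fix x assume "x \<in> {0<..<X}"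
    then have x: "complex_of_real x \<notin> \<real>\<^sub>\<le>\<^sub>0" by (auto simp: complex_nonpos_Reals_iff)
    have "((\<lambda>z. z powr (p + 1) / (p + 1)) has_field_derivative complex_of_real x powr p) (at (complex_of_real x))"
      using x \<open>p + 1 \<noteq> 0\<close> by (auto intro!: derivative_eq_intros)
    from has_vector_derivative_real_field[OF this]
    show "((\<lambda>x. complex_of_real x powr (p + 1) / (p + 1)) has_vector_derivative complex_of_real x powr p) (at x)"
      by simp
  qed
  then have "(LINT x:{0..X}|lborel. complex_of_real x powr p) = complex_of_real X powr (p + 1) / (p + 1)"
    using set_borel_integral_eq_integral(2)[OF int] by (simp add: integral_unique)
  then show ?thesis
    using int by (simp add: has_bochner_integral_iff set_integrable_def set_lebesgue_integral_def)
qed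

lemma borel_measurable_fst_real2 [measurable]: "fst \<in> borel_measurable (borel :: (real \<times> real) measure)"
  by (intro borel_measurable_continuous_onI continuous_intros)

lemma borel_measurable_snd_real2 [measurable]: "snd \<in> borel_measurable (borel :: (real \<times> real) measure)"
  by (intro borel_measurable_continuous_onI continuous_intros)

text \<open>For a nonnegative base no branch of the logarithm interferes, and the base 0 fits by
  \<open>0 powr s = 0\<close>.\<close>

lemma of_real_powr_powr:
  assumes "x \<ge> 0"
  shows "complex_of_real (x powr r) powr s = complex_of_real x powr (of_real r * s)"
proof (cases "x = 0")
  case False
  then show ?thesis using assms by (simp add: powr_def Ln_of_real ln_powr[unfolded powr_def] mult_ac)
qed simp

section \<open>The function N in sheared coordinates\<close>

context weighted_homogeneous_isolated
begin

definition N :: "real \<times> real \<Rightarrow> real" where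
  "N z = fst z ^ (2 * b) + snd z ^ (2 * a)"

lemma N_nonneg [simp]: "N z \<ge> 0"
  by (simp add: N_def)

lemma continuous_on_N [continuous_intros]: "continuous_on S N"
  unfolding N_def[abs_def] by (intro continuous_intros)

lemma borel_measurable_N [measurable]: "N \<in> borel_measurable borel"
  by (intro borel_measurable_continuous_onI continuous_intros)

lemma borel_measurable_f [measurable]: "(\<lambda>z. poly2 f (fst z) (snd z)) \<in> borel_measurable borel"
  by (intro borel_measurable_continuous_onI continuous_intros)

lemma f_shear:
  assumes "x \<noteq> 0"
  shows "poly2 f x (\<bar>x\<bar> powr (b / a) * u) = \<bar>x\<bar> powr (m / a) * poly2 f (sgn x) u"
proof -
  define c where "c = \<bar>x\<bar> powr (1 / a)"
  have c: "c ^ n = \<bar>x\<bar> powr (n / a)" for n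
    using assms by (simp add: c_def powr_realpow[symmetric] powr_powr)
  have "poly2 f (c ^ a * sgn x) (c ^ b * u) = c ^ m * poly2 f (sgn x) u"
    by (simp add: weighted_homogeneousD[OF homogeneous])
  moreover have "c ^ a * sgn x = x" using a_pos assms by (simp add: c sgn_real_def)
  ultimately show ?thesis by (simp add: c)
qed

lemma N_shear:
  assumes "x \<noteq> 0"
  shows "N (x, \<bar>x\<bar> powr (b / a) * u) = \<bar>x\<bar> powr (2 * b) * W u"
proof -
  have "(\<bar>x\<bar> powr (b / a)) ^ (2 * a) = \<bar>x\<bar> powr (2 * b)"
    using assms a_pos by (simp add: powr_realpow[symmetric] powr_powr mult.commute)
  moreover have "x ^ (2 * b) = \<bar>x\<bar> powr (2 * b)"
    using assms powr_realpow[of "\<bar>x\<bar>" "2 * b"] by (simp add: power_even_abs)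
  ultimately show ?thesis by (simp add: N_def W_def power_mult_distrib distrib_left)
qed

text \<open>Half the length of the x-section of \<open>{N \<le> R}\<close> at fixed \<open>u\<close>
  in sheared coordinates.\<close>

definition X :: "real \<Rightarrow> real \<Rightarrow> real" where
  "X R u = (R / W u) powr (1 / (2 * b))"

lemma N_shear_le_iff:
  assumes "x \<noteq> 0" "R > 0"
  shows "N (x, \<bar>x\<bar> powr (b / a) * u) \<le> R \<longleftrightarrow> \<bar>x\<bar> \<le> X R u"
proof -
  have "N (x, \<bar>x\<bar> powr (b / a) * u) \<le> R \<longleftrightarrow> \<bar>x\<bar> powr (2 * b) \<le> R / W u"
    using assms by (simp add: N_shear pos_le_divide_eq)
  also have "\<dots> \<longleftrightarrow> (\<bar>x\<bar> powr (2 * b)) powr (1 / (2 * b)) \<le> (R / W u) powr (1 / (2 * b))"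
    using powr_mono2[of "1 / (2 * b)" "\<bar>x\<bar> powr (2 * b)" "R / W u"]
      powr_less_mono2[of "1 / (2 * b)" "R / W u" "\<bar>x\<bar> powr (2 * b)"] assms b_pos
    by (cases "\<bar>x\<bar> powr (2 * b) \<le> R / W u") (auto simp: less_imp_le not_le)
  also have "(\<bar>x\<bar> powr (2 * b)) powr (1 / (2 * b)) = \<bar>x\<bar>"
    using assms b_pos by (simp add: powr_powr)
  finally show ?thesis by (simp add: X_def)
qed

text \<open>In sheared coordinates the integrand is a pure power of \<open>|x|\<close> with exponent
  \<open>p\<close>, cut off at \<open>X R u\<close>, and the hypothesis on \<open>w\<close> says
  \<open>p > -1\<close>. Integrating over \<open>x\<close> contributes
  \<open>W u powr (-(p + 1)/2b)\<close>, after which \<open>w\<close> cancels and the fibre integral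
  is that of \<open>integrable_fibre\<close>.\<close>

lemma integrable_weight:
  fixes \<sigma> w R :: real
  assumes \<sigma>: "\<sigma> > -1" and w: "m * \<sigma> + a + b + 2 * a * b * w > 0" and R: "R > 0"
  shows "integrable lborel (\<lambda>z. \<bar>poly2 f (fst z) (snd z)\<bar> powr \<sigma> * N z powr w * indicator {z. N z \<le> R} z)"
    (is "integrable _ ?h")
proof -
  \<comment> \<open>The summands come from the Jacobian, from the homogeneity of f and from that of
    \<open>N\<close>.\<close>
  define p where "p = b / a + m / a * \<sigma> + 2 * b * w"
  have p: "p > -1" "p + 1 = (m * \<sigma> + a + b + 2 * a * b * w) / a"
    using w a_pos by (auto simp: p_def field_simps)
  define A where "A = (\<lambda>\<epsilon> u. \<bar>poly2 f \<epsilon> u\<bar> powr \<sigma> * W u powr w)"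
  let ?H = "\<lambda>z. \<bar>snd z\<bar> powr (b / a) *\<^sub>R ?h (shear (b / a) z)"
  have h_meas: "?h \<in> borel_measurable borel" by measurable
  have H_meas: "?H \<in> borel_measurable borel"
    using measurable_compose[OF measurable_shear h_meas] by measurable
  have inner: "has_bochner_integral lborel (\<lambda>x. ?H (u, x)) ((A 1 u + A (- 1) u) * (X R u powr (p + 1) / (p + 1)))" for u
  proof (rule has_bochner_integral_two_sided[OF has_bochner_integral_real_powr[OF p(1)]])
    show "X R u \<ge> 0" by (simp add: X_def)
    have H: "?H (u, x) = (if \<bar>x\<bar> \<le> X R u then A (sgn x) u * \<bar>x\<bar> powr p else 0)" if "x \<noteq> 0" for x
    proof -
      have ind: "indicat_real {z. N z \<le> R} (x, \<bar>x\<bar> powr (b / a) * u) = (if \<bar>x\<bar> \<le> X R u then 1 else 0)"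
        using N_shear_le_iff[OF that R, of u] by (simp add: indicator_def)
      show ?thesis
        using that
        by (simp add: shear_def ind f_shear[OF that] N_shear[OF that] A_def p_def powr_add abs_mult powr_mult powr_powr)
    qed
    show "?H (u, x) = A 1 u * x powr p" if "x > 0" "x \<le> X R u" for x
      using H[of x] that by simp
    show "?H (u, x) = A (- 1) u * (- x) powr p" if "x < 0" "- x \<le> X R u" for x
      using H[of x] that by simp
    show "?H (u, x) = 0" if "\<bar>x\<bar> > X R u" for x
      using H[of x] that by (cases "x = 0") (auto simp: X_def)
    show "(\<lambda>x. ?H (u, x)) \<in> borel_measurable borel"
      using H_meas by (rule measurable_compose[rotated]) (simp add: borel_prod[symmetric])
  qed
  have H_nonneg: "?H z \<ge> 0" for z by (intro scaleR_nonneg_nonneg mult_nonneg_nonneg) auto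
  have fib: "integrable lborel (\<lambda>u. (A 1 u + A (- 1) u) * (X R u powr (p + 1) / (p + 1)))"
  proof -
    have e: "(A 1 u + A (- 1) u) * (X R u powr (p + 1) / (p + 1)) =
      R powr ((p + 1) / (2 * b)) / (p + 1) *
        (\<bar>poly2 f 1 u\<bar> powr \<sigma> * W u powr (- ((m * \<sigma> + a + b) / (2 * a * b)))
         + \<bar>poly2 f (-1) u\<bar> powr \<sigma> * W u powr (- ((m * \<sigma> + a + b) / (2 * a * b))))" for u
    proof -
      have "X R u powr (p + 1) = R powr ((p + 1) / (2 * b)) * W u powr (- ((p + 1) / (2 * b)))"
        using R W_pos[of u] by (simp add: X_def powr_powr powr_divide powr_minus less_imp_le field_simps del: W_pos)
      moreover have "w - (p + 1) / (2 * b) = - ((m * \<sigma> + a + b) / (2 * a * b))"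
        unfolding p(2) using a_pos b_pos by (simp add: field_simps)
      then have "W u powr w * W u powr (- ((p + 1) / (2 * b))) = W u powr (- ((m * \<sigma> + a + b) / (2 * a * b)))"
        by (simp add: powr_add[symmetric])
      ultimately show ?thesis by (simp add: A_def distrib_right distrib_left mult.assoc mult.left_commute add_divide_distrib)
    qed
    show ?thesis unfolding e
      by (intro integrable_mult_right Bochner_Integration.integrable_add integrable_fibre \<sigma>) auto
  qed
  have "integrable (lborel \<Otimes>\<^sub>M lborel) ?H"
  proof (rule lborel_pair.Fubini_integrable)
    show "?H \<in> borel_measurable (lborel \<Otimes>\<^sub>M lborel)"
      using H_meas by (simp add: lborel_prod)
    have "(\<lambda>u. LINT x|lborel. norm (?H (u, x))) = (\<lambda>u. (A 1 u + A (- 1) u) * (X R u powr (p + 1) / (p + 1)))"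
    proof
      fix u
      have "(LINT x|lborel. norm (?H (u, x))) = (LINT x|lborel. ?H (u, x))"
        using H_nonneg by (intro Bochner_Integration.integral_cong refl) (simp only: real_norm_def abs_of_nonneg)
      then show "(LINT x|lborel. norm (?H (u, x))) = (A 1 u + A (- 1) u) * (X R u powr (p + 1) / (p + 1))"
        using has_bochner_integral_integral_eq[OF inner] by simp
    qed
    then show "integrable lborel (\<lambda>u. LINT x|lborel. norm (?H (u, x)))"
      using fib by simp
    show "AE u in lborel. integrable lborel (\<lambda>x. ?H (u, x))"
      by (rule AE_I2) (rule integrable.intros[OF inner])
  qed
  then show ?thesis
    using integrable_shear_iff[OF h_meas, of "b / a"] by (simp add: lborel_prod)
qed

end

lemma integrable_complex_powr:
  fixes g \<psi> :: "'a \<Rightarrow> real"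
  assumes "\<And>z. g z \<ge> 0" and [measurable]: "g \<in> borel_measurable M" "\<psi> \<in> borel_measurable M"
    and "integrable M (\<lambda>z. g z powr Re s * \<psi> z)"
  shows "integrable M (\<lambda>z. complex_of_real (g z) powr s * complex_of_real (\<psi> z))"
proof (rule Bochner_Integration.integrable_bound[OF assms(4)])
  show "AE z in M. norm (complex_of_real (g z) powr s * complex_of_real (\<psi> z)) \<le> norm (g z powr Re s * \<psi> z)"
    using assms(1) by (intro AE_I2) (simp add: norm_mult norm_powr_real_powr abs_mult)
qed measurable

lemma of_real_mult_powr:
  assumes "x \<ge> 0" "y \<ge> 0"
  shows "complex_of_real (x * y) powr s = complex_of_real x powr s * complex_of_real y powr s"
  using assms by (simp add: powr_times_real)

section \<open>Integrability against remainders and the integral of one monomial\<close>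

context weighted_homogeneous_isolated
begin

lemma f_origin [simp]: "poly2 f 0 0 = 0"
  using weighted_homogeneousD[OF homogeneous, of 0 0 0] zero_power[OF m_pos, where 'a = real] by auto

lemma N_pos: "z \<noteq> 0 \<Longrightarrow> N z > 0"
  using a_pos b_pos by (cases z) (auto simp: N_def zero_prod_def zero_less_power_eq intro: add_pos_nonneg add_nonneg_pos)

text \<open>The bound is asked only off 0, because \<open>0 powr w = 0\<close> would turn it into
  \<open>\<psi> 0 = 0\<close>; at 0 the factor from f vanishes anyway.\<close>

lemma integrable_f_powr:
  fixes \<psi> :: "real \<times> real \<Rightarrow> real" and \<sigma> w R C :: real
  assumes \<sigma>: "\<sigma> > -1" and w: "m * \<sigma> + a + b + 2 * a * b * w > 0" and R: "R > 0"
    and [measurable]: "\<psi> \<in> borel_measurable borel"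
    and bound: "\<And>z. z \<noteq> 0 \<Longrightarrow> \<bar>\<psi> z\<bar> \<le> C * N z powr w * indicator {z. N z \<le> R} z"
  shows "integrable lborel (\<lambda>z. \<bar>poly2 f (fst z) (snd z)\<bar> powr \<sigma> * \<psi> z)"
proof (rule Bochner_Integration.integrable_bound[OF integrable_mult_right[OF integrable_weight[OF \<sigma> w R], of C]])
  show "AE z in lborel. norm (\<bar>poly2 f (fst z) (snd z)\<bar> powr \<sigma> * \<psi> z)
      \<le> norm (C * (\<bar>poly2 f (fst z) (snd z)\<bar> powr \<sigma> * N z powr w * indicator {z. N z \<le> R} z))"
  proof (rule AE_I2)
    fix z
    show "norm (\<bar>poly2 f (fst z) (snd z)\<bar> powr \<sigma> * \<psi> z)
      \<le> norm (C * (\<bar>poly2 f (fst z) (snd z)\<bar> powr \<sigma> * N z powr w * indicator {z. N z \<le> R} z))"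
    proof (cases "z = 0")
      case False
      have "norm (\<bar>poly2 f (fst z) (snd z)\<bar> powr \<sigma> * \<psi> z) = \<bar>poly2 f (fst z) (snd z)\<bar> powr \<sigma> * \<bar>\<psi> z\<bar>"
        by (simp add: abs_mult)
      also have "\<dots> \<le> \<bar>poly2 f (fst z) (snd z)\<bar> powr \<sigma> * (C * N z powr w * indicator {z. N z \<le> R} z)"
        by (intro mult_left_mono bound False) auto
      also have "\<dots> = C * (\<bar>poly2 f (fst z) (snd z)\<bar> powr \<sigma> * N z powr w * indicator {z. N z \<le> R} z)"
        by (simp only: mult_ac)
      also have "\<dots> \<le> norm \<dots>" by (simp only: real_norm_def abs_ge_self)
      finally show ?thesis .
    qed simp
  qed
qed measurable

text \<open>The weighted degree of \<open>x^j y^k dx dy\<close>; its negative divided by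
  \<open>m\<close> is the candidate pole of that monomial.\<close>

definition level_weight :: "nat \<Rightarrow> nat \<Rightarrow> real" where
  "level_weight j k = (real j + 1) * real a + (real k + 1) * real b"

text \<open>The restriction to \<open>x = 1\<close> and \<open>x = -1\<close> of
  \<open>|f| N powr (-m/2ab)\<close>, which is invariant under the weighted scaling;
  \<open>\<psi>\<close> below is normalised in the same way by the weight of
  \<open>x^j y^k dx dy\<close>.\<close>

definition G :: "real \<Rightarrow> real \<Rightarrow> real" where
  "G x u = \<bar>poly2 f x u\<bar> * W u powr (- (m / (2 * a * b)))"

definition \<psi> :: "nat \<Rightarrow> nat \<Rightarrow> real \<Rightarrow> real" where
  "\<psi> j k u = u ^ k * W u powr (- (level_weight j k / (2 * a * b)))"

text \<open>The two fibres stay separate integrals, since their bases differ and holomorphy is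
  proved for one base at a time.\<close>

definition H :: "nat \<Rightarrow> nat \<Rightarrow> complex \<Rightarrow> complex" where
  "H j k s = (LINT u|lborel. complex_of_real (G 1 u) powr s * complex_of_real (\<psi> j k u))
    + (-1) ^ j * (LINT u|lborel. complex_of_real (G (-1) u) powr s * complex_of_real (\<psi> j k u))"

lemma G_nonneg [simp]: "G x u \<ge> 0"
  by (simp add: G_def)

lemma borel_measurable_G [measurable]: "G x \<in> borel_measurable borel"
  unfolding G_def[abs_def] by measurable

lemma borel_measurable_\<psi> [measurable]: "\<psi> j k \<in> borel_measurable borel"
  unfolding \<psi>_def[abs_def] by measurable

lemma G_powr:
  fixes \<sigma> :: real
  shows "G x u powr \<sigma> = \<bar>poly2 f x u\<bar> powr \<sigma> * W u powr (- (m * \<sigma> / (2 * a * b)))"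
  by (simp add: G_def powr_mult powr_powr)

text \<open>The bound \<open>|u|^k \<le> W u powr (k/2a)\<close> uses up \<open>k b\<close> of the
  weight in \<open>\<psi>\<close>; at least the \<open>a + b\<close> of
  \<open>integrable_fibre\<close> remains.\<close>

lemma integrable_G_\<psi>:
  fixes x \<sigma> :: real
  assumes x: "\<bar>x\<bar> = 1" and \<sigma>: "\<sigma> > -1"
  shows "integrable lborel (\<lambda>u. G x u powr \<sigma> * \<psi> j k u)"
proof (rule Bochner_Integration.integrable_bound[OF integrable_fibre[OF assms]])
  show "AE u in lborel. norm (G x u powr \<sigma> * \<psi> j k u)
      \<le> norm (\<bar>poly2 f x u\<bar> powr \<sigma> * W u powr (- ((m * \<sigma> + a + b) / (2 * a * b))))"
  proof (rule AE_I2)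
    fix u
    have uk: "\<bar>u ^ k\<bar> \<le> W u powr (k / (2 * a))"
    proof (cases "u = 0")
      case True
      then show ?thesis using W_pos[of u] by (cases k) (auto simp del: W_pos)
    next
      case False
      then have "\<bar>u ^ k\<bar> = (\<bar>u\<bar> powr (2 * a)) powr (k / (2 * a))"
        using a_pos by (simp add: power_abs powr_realpow[symmetric] powr_powr)
      also have "\<bar>u\<bar> powr (2 * a) = u ^ (2 * a)"
        using False powr_realpow[of "\<bar>u\<bar>" "2 * a"] by (simp add: power_even_abs)
      also have "(u ^ (2 * a)) powr (k / (2 * a)) \<le> W u powr (k / (2 * a))"
        by (intro powr_mono2) (auto simp: W_def)
      finally show ?thesis .
    qed
    have "norm (G x u powr \<sigma> * \<psi> j k u) = \<bar>poly2 f x u\<bar> powr \<sigma> *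
        (W u powr (- (m * \<sigma> / (2 * a * b))) * (\<bar>u ^ k\<bar> * W u powr (- (level_weight j k / (2 * a * b)))))"
      by (simp add: G_powr \<psi>_def abs_mult)
    also have "\<dots> \<le> \<bar>poly2 f x u\<bar> powr \<sigma> *
        (W u powr (- (m * \<sigma> / (2 * a * b))) * (W u powr (k / (2 * a)) * W u powr (- (level_weight j k / (2 * a * b)))))"
      by (intro mult_left_mono mult_right_mono uk) auto
    also have "\<dots> = \<bar>poly2 f x u\<bar> powr \<sigma> *
        W u powr (- (m * \<sigma> / (2 * a * b)) + (k / (2 * a) + - (level_weight j k / (2 * a * b))))"
      by (simp only: powr_add)
    also have "\<dots> \<le> \<bar>poly2 f x u\<bar> powr \<sigma> * W u powr (- ((m * \<sigma> + a + b) / (2 * a * b)))"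
      using a_pos b_pos W_ge_1[of u]
      by (intro mult_left_mono powr_mono) (auto simp: level_weight_def field_simps)
    finally show "norm (G x u powr \<sigma> * \<psi> j k u)
      \<le> norm (\<bar>poly2 f x u\<bar> powr \<sigma> * W u powr (- ((m * \<sigma> + a + b) / (2 * a * b))))" by simp
  qed
qed measurable

lemma holomorphic_H: "H j k holomorphic_on {s. Re s > -1}"
  unfolding H_def[abs_def]
  by (intro holomorphic_intros holomorphic_on_integral_powr integrable_G_\<psi>) auto

text \<open>At a resonance the powers of \<open>W\<close> in \<open>G\<close> and
  \<open>\<psi>\<close> are inverse to each other. Absolute convergence of the integral in (2) comes
  along, so its value is never a default 0.\<close>

lemma H_resonant:
  fixes s0 :: real
  assumes s0: "s0 > -1" and res: "- real m * s0 = level_weight j k"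
  shows "H j k (complex_of_real s0) = complex_of_real
    (LINT u|lborel. (\<bar>poly2 f 1 u\<bar> powr s0 + (-1) ^ j * \<bar>poly2 f (-1) u\<bar> powr s0) * u ^ k)"
proof -
  have eq: "G x u powr s0 * \<psi> j k u = \<bar>poly2 f x u\<bar> powr s0 * u ^ k" for x u
  proof -
    have "- (level_weight j k / (2 * a * b)) = m * s0 / (2 * a * b)"
      using res by (simp flip: res)
    moreover have "W u powr (- (m * s0 / (2 * a * b))) * W u powr (m * s0 / (2 * a * b)) = 1"
      using W_pos[of u] by (simp flip: powr_add del: W_pos)
    ultimately show ?thesis
      unfolding G_powr \<psi>_def by (simp only: mult_ac)
  qed
  have c: "(LINT u|lborel. complex_of_real (G x u) powr complex_of_real s0 * complex_of_real (\<psi> j k u))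
      = complex_of_real (LINT u|lborel. \<bar>poly2 f x u\<bar> powr s0 * u ^ k)" for x
    by (simp add: powr_of_real eq del: of_real_mult flip: of_real_mult)
  have int: "integrable lborel (\<lambda>u. \<bar>poly2 f x u\<bar> powr s0 * u ^ k)" if "\<bar>x\<bar> = 1" for x
    using integrable_G_\<psi>[OF that s0, of j k] by (simp add: eq)
  have "(LINT u|lborel. (\<bar>poly2 f 1 u\<bar> powr s0 + (-1) ^ j * \<bar>poly2 f (-1) u\<bar> powr s0) * u ^ k)
    = (LINT u|lborel. \<bar>poly2 f 1 u\<bar> powr s0 * u ^ k + (-1) ^ j * (\<bar>poly2 f (-1) u\<bar> powr s0 * u ^ k))"
    by (simp add: distrib_right mult.assoc)
  also have "\<dots> = (LINT u|lborel. \<bar>poly2 f 1 u\<bar> powr s0 * u ^ k)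
      + (-1) ^ j * (LINT u|lborel. \<bar>poly2 f (-1) u\<bar> powr s0 * u ^ k)"
    using int[of 1] int[of "-1"] by (subst Bochner_Integration.integral_add) auto
  finally show ?thesis by (simp add: H_def c)
qed

text \<open>For \<open>Re s > 0\<close> boundedness of the monomial on \<open>N \<le> 1\<close>
  already gives convergence. Integrating the power \<open>p\<close> of \<open>x\<close> up to
  \<open>X 1 u\<close> produces the denominator \<open>p + 1\<close> and, through the upper limit,
  the powers of \<open>W\<close> inside \<open>H\<close>.\<close>

lemma
  fixes j k :: nat and s :: complex
  assumes s: "Re s > 0"
  defines "h \<equiv> \<lambda>z. complex_of_real \<bar>poly2 f (fst z) (snd z)\<bar> powr s *
      complex_of_real (fst z ^ j * snd z ^ k * indicator {z. N z \<le> 1} z)"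
  shows integrable_monomial: "integrable lborel h"
    and integral_monomial: "(LINT z|lborel. h z) = a * H j k s / (m * s + level_weight j k)"
proof -
  have le1: "\<bar>fst z ^ j * snd z ^ k\<bar> \<le> 1" if "N z \<le> 1" for z
  proof -
    have "fst z ^ (2 * b) \<ge> 0" "snd z ^ (2 * a) \<ge> 0" by simp_all
    then have "fst z ^ (2 * b) \<le> 1" "snd z ^ (2 * a) \<le> 1"
      using that unfolding N_def by linarith+
    then have "\<bar>fst z\<bar> \<le> 1" "\<bar>snd z\<bar> \<le> 1"
      using a_pos b_pos power_le_one_iff[of "\<bar>fst z\<bar>" "2 * b"] power_le_one_iff[of "\<bar>snd z\<bar>" "2 * a"]
      by (simp_all add: power_even_abs)
    then show ?thesis
      by (simp add: abs_mult power_abs mult_le_one power_le_one)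
  qed
  have pos: "real m * Re s + a + b > 0"
    by (rule add_pos_nonneg[OF add_nonneg_pos]) (use s a_pos in auto)
  show int: "integrable lborel h" unfolding h_def
  proof (intro integrable_complex_powr)
    show "integrable lborel (\<lambda>z. \<bar>poly2 f (fst z) (snd z)\<bar> powr Re s * (fst z ^ j * snd z ^ k * indicator {z. N z \<le> 1} z))"
    proof (rule integrable_f_powr[where C = 1 and w = 0 and R = 1])
      show "\<bar>fst z ^ j * snd z ^ k * indicator {z. N z \<le> 1} z\<bar> \<le> 1 * N z powr 0 * indicator {z. N z \<le> 1} z" if "z \<noteq> 0" for z
        using N_pos[OF that] le1[of z] by (auto simp: indicator_def)
    qed (use s pos in auto)
  qed auto
  have h_meas: "h \<in> borel_measurable borel" unfolding h_def by measurable
  \<comment> \<open>Contributions of the Jacobian, of f, of \<open>y^k\<close> and of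
    \<open>x^j\<close>.\<close>
  define p where "p = of_real (b / a) + of_real (m / a) * s + of_real (b / a * k) + of_nat j"
  have p: "Re p > -1" using s by (simp add: p_def add_nonneg_nonneg less_le_trans[of "-1" 0])
  \<comment> \<open>The division by \<open>a\<close> is the origin of the factor \<open>a\<close> in
    the result.\<close>
  have p1: "p + 1 = (m * s + level_weight j k) / a"
    using a_pos by (simp add: p_def level_weight_def field_simps)
  define A where "A = (\<lambda>x u. complex_of_real \<bar>poly2 f x u\<bar> powr s * complex_of_real (u ^ k))"
  let ?h = "\<lambda>z. \<bar>snd z\<bar> powr (b / a) *\<^sub>R h (shear (b / a) z)"
  have inner: "has_bochner_integral lborel (\<lambda>x. ?h (u, x))
      ((A 1 u + (-1) ^ j * A (- 1) u) * (complex_of_real (X 1 u) powr (p + 1) / (p + 1)))" for u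
  proof (rule has_bochner_integral_two_sided[OF has_bochner_integral_complex_powr[OF p]])
    show "X 1 u \<ge> 0" by (simp add: X_def)
    have pw: "complex_of_real x powr p = of_real (x powr (b / a)) * of_real (x powr (m / a)) powr s
        * of_real ((x powr (b / a)) ^ k * x ^ j)" if "x > 0" for x
    proof -
      have "(x powr (b / a)) ^ k = x powr (b / a * k)"
        using that by (simp add: powr_realpow[symmetric] powr_powr)
      moreover have "complex_of_real x powr of_nat j = of_real (x ^ j)"
        using that by (simp add: powr_nat)
      ultimately show ?thesis
        using that by (simp add: p_def powr_add of_real_powr_powr powr_of_real flip: of_real_mult of_real_divide) simp
    qed
    have H: "?h (u, x) = (if \<bar>x\<bar> \<le> X 1 u then of_real (sgn x ^ j) * A (sgn x) u * complex_of_real \<bar>x\<bar> powr p else 0)"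
      if "x \<noteq> 0" for x
    proof -
      have ind: "indicat_real {z. N z \<le> 1} (x, \<bar>x\<bar> powr (b / a) * u) = (if \<bar>x\<bar> \<le> X 1 u then 1 else 0)"
        using N_shear_le_iff[OF that, of 1 u] by (simp add: indicator_def)
      \<comment> \<open>The sign of \<open>x^j\<close> on the left half-plane is the source of
        \<open>(-1) ^ j\<close> in \<open>H\<close>.\<close>
      have xj: "x ^ j = sgn x ^ j * \<bar>x\<bar> ^ j" by (simp add: sgn_mult_abs flip: power_mult_distrib)
      have "?h (u, x) = (if \<bar>x\<bar> \<le> X 1 u then of_real (\<bar>x\<bar> powr (b / a)) *
          (of_real (\<bar>x\<bar> powr (m / a) * \<bar>poly2 f (sgn x) u\<bar>) powr s * of_real (x ^ j * (\<bar>x\<bar> powr (b / a) * u) ^ k)) else 0)"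
        using that by (simp add: shear_def h_def ind f_shear[OF that] abs_mult scaleR_conv_of_real)
      also have "\<dots> = (if \<bar>x\<bar> \<le> X 1 u then of_real (sgn x ^ j) * A (sgn x) u * complex_of_real \<bar>x\<bar> powr p else 0)"
        using that by (subst of_real_mult_powr) (auto simp: A_def pw xj power_mult_distrib mult_ac)
      finally show ?thesis .
    qed
    show "?h (u, x) = A 1 u * complex_of_real x powr p" if "x > 0" "x \<le> X 1 u" for x
      using H[of x] that by simp
    show "?h (u, x) = (-1) ^ j * A (- 1) u * complex_of_real (- x) powr p" if "x < 0" "- x \<le> X 1 u" for x
      using H[of x] that by simp
    show "?h (u, x) = 0" if "\<bar>x\<bar> > X 1 u" for x
      using H[of x] that by (cases "x = 0") (auto simp: X_def)
    have "?h \<in> borel_measurable borel"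
      using measurable_compose[OF measurable_shear h_meas] by measurable
    then show "(\<lambda>x. ?h (u, x)) \<in> borel_measurable borel"
      by (rule measurable_compose[rotated]) (simp add: borel_prod[symmetric])
  qed
  have outer: "A x u * complex_of_real (X 1 u) powr (p + 1) = complex_of_real (G x u) powr s * complex_of_real (\<psi> j k u)" for x u
  proof -
    define r1 r2 where "r1 = - (m / (2 * a * b))" and "r2 = - (level_weight j k / (2 * a * b))"
    have "X 1 u = W u powr (- (1 / (2 * b)))"
      using W_pos[of u] by (simp add: X_def powr_divide powr_minus_divide less_imp_le del: W_pos)
    moreover have "of_real (- (1 / (2 * b))) * (p + 1) = of_real r1 * s + of_real r2"
      unfolding p1 r1_def r2_def using a_pos b_pos by (simp add: field_simps)
    ultimately have "complex_of_real (X 1 u) powr (p + 1) = of_real (W u) powr (of_real r1 * s + of_real r2)"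
      using W_pos[of u] by (simp only: of_real_powr_powr less_imp_le)
    also have "\<dots> = complex_of_real (W u powr r1) powr s * of_real (W u powr r2)"
      using W_pos[of u] powr_of_real[of "W u" r2]
      by (simp only: powr_add of_real_powr_powr less_imp_le)
    finally have X: "complex_of_real (X 1 u) powr (p + 1) = complex_of_real (W u powr r1) powr s * of_real (W u powr r2)" .
    have "complex_of_real (G x u) powr s = of_real \<bar>poly2 f x u\<bar> powr s * of_real (W u powr r1) powr s"
      unfolding G_def r1_def by (rule of_real_mult_powr) auto
    moreover have "complex_of_real (\<psi> j k u) = of_real (u ^ k) * of_real (W u powr r2)"
      by (simp add: \<psi>_def r2_def)
    ultimately show ?thesis by (simp only: A_def X mult_ac)
  qed
  have "integrable (lborel \<Otimes>\<^sub>M lborel) ?h"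
    using integrable_shear_iff[OF h_meas, of "b / a"] int by (simp add: lborel_prod)
  from lborel_pair.integral_fst'[OF this]
  have "(LINT z|lborel. h z) = (LINT u|lborel. LINT x|lborel. ?h (u, x))"
    using integral_shear[OF h_meas, of "b / a"] by (simp add: lborel_prod)
  also have "\<dots> = (LINT u|lborel. (A 1 u + (-1) ^ j * A (- 1) u) * (complex_of_real (X 1 u) powr (p + 1) / (p + 1)))"
    using has_bochner_integral_integral_eq[OF inner] by simp
  also have "\<dots> = (LINT u|lborel. (complex_of_real (G 1 u) powr s * complex_of_real (\<psi> j k u)
      + (-1) ^ j * (complex_of_real (G (-1) u) powr s * complex_of_real (\<psi> j k u))) / (p + 1))"
    by (intro Bochner_Integration.integral_cong refl) (simp add: distrib_right mult.assoc flip: outer)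
  also have "\<dots> = H j k s / (p + 1)"
    using s unfolding integral_divide_zero H_def
    by (subst Bochner_Integration.integral_add)
      (auto intro!: integrable_complex_powr integrable_G_\<psi> integrable_mult_right)
  also have "\<dots> = a * H j k s / (m * s + level_weight j k)"
    by (simp add: p1)
  finally show "(LINT z|lborel. h z) = a * H j k s / (m * s + level_weight j k)" .
qed

end

section \<open>Taylor expansion and smooth cutoffs\<close>

lemma ck_fun_Suc_iff:
  "ck_fun (Suc k) \<phi> \<longleftrightarrow> (\<exists>\<phi>x \<phi>y. (\<forall>p. (\<phi> has_derivative (\<lambda>h. \<phi>x p * fst h + \<phi>y p * snd h)) (at p)) \<and>
    ck_fun k \<phi>x \<and> ck_fun k \<phi>y)"
  by (simp add: case_prod_beta')

declare ck_fun.simps(2) [simp del]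

lemma ck_fun_SucI:
  assumes "\<And>p. (\<phi> has_derivative (\<lambda>h. \<phi>x p * fst h + \<phi>y p * snd h)) (at p)" "ck_fun k \<phi>x" "ck_fun k \<phi>y"
  shows "ck_fun (Suc k) \<phi>"
  unfolding ck_fun_Suc_iff using assms by blast

lemma ck_fun_SucE:
  assumes "ck_fun (Suc k) \<phi>"
  obtains \<phi>x \<phi>y where "\<forall>p. (\<phi> has_derivative (\<lambda>h. \<phi>x p * fst h + \<phi>y p * snd h)) (at p)"
    "ck_fun k \<phi>x" "ck_fun k \<phi>y"
  using assms unfolding ck_fun_Suc_iff by (elim exE conjE) (rule that)

lemma ck_fun_SucD: "ck_fun (Suc k) \<phi> \<Longrightarrow> ck_fun k \<phi>"
proof (induction k arbitrary: \<phi>)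
  case 0
  then obtain \<phi>x \<phi>y where d: "\<forall>p. (\<phi> has_derivative (\<lambda>h. \<phi>x p * fst h + \<phi>y p * snd h)) (at p)"
    "ck_fun 0 \<phi>x" "ck_fun 0 \<phi>y" by (rule ck_fun_SucE)
  have "isCont \<phi> p" for p using d(1)[rule_format] by (rule has_derivative_continuous)
  then show ?case by (simp add: continuous_at_imp_continuous_on)
next
  case (Suc k)
  from Suc.prems obtain \<phi>x \<phi>y where d: "\<forall>p. (\<phi> has_derivative (\<lambda>h. \<phi>x p * fst h + \<phi>y p * snd h)) (at p)"
    and c: "ck_fun (Suc k) \<phi>x" "ck_fun (Suc k) \<phi>y" by (rule ck_fun_SucE)
  show ?case by (rule ck_fun_SucI[OF d[rule_format] Suc.IH[OF c(1)] Suc.IH[OF c(2)]])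
qed

lemma ck_fun_imp_continuous_on: "ck_fun k \<phi> \<Longrightarrow> continuous_on UNIV \<phi>"
  by (induction k) (auto dest: ck_fun_SucD)

text \<open>Exponents may repeat in the list, so polynomials are added by concatenation and handled
  by list induction.\<close>

definition monomial_sum :: "(real \<times> nat \<times> nat) list \<Rightarrow> real \<times> real \<Rightarrow> real" where
  "monomial_sum L z = (\<Sum>(c, j, k)\<leftarrow>L. c * (fst z ^ j * snd z ^ k))"

lemma monomial_sum_Nil [simp]: "monomial_sum [] z = 0"
  and monomial_sum_Cons [simp]: "monomial_sum ((c, j, k) # L) z = c * (fst z ^ j * snd z ^ k) + monomial_sum L z"
  and monomial_sum_append [simp]: "monomial_sum (L @ L') z = monomial_sum L z + monomial_sum L' z"
  by (auto simp: monomial_sum_def)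

lemma continuous_on_monomial_sum [continuous_intros]: "continuous_on S (monomial_sum L)"
proof (induction L)
  case (Cons t L)
  then show ?case by (cases t) (auto intro!: continuous_intros)
qed simp

lemma borel_measurable_monomial_sum [measurable]: "monomial_sum L \<in> borel_measurable borel"
  by (intro borel_measurable_continuous_onI continuous_intros)

text \<open>A primitive along rays from the origin, not in \<open>x\<close> alone: at
  \<open>(t x, t y)\<close> the monomial has degree \<open>j + k\<close> in \<open>t\<close>, whence
  the divisor \<open>j + k + 1\<close>.\<close>

definition antideriv_x where "antideriv_x L = map (\<lambda>(c, j, k). (c / (j + k + 1), Suc j, k)) L"

definition antideriv_y where "antideriv_y L = map (\<lambda>(c, j, k). (c / (j + k + 1), j, Suc k)) L"

lemma antideriv_x_derivative:
  "((\<lambda>t. monomial_sum (antideriv_x L) (t * x, t * y)) has_field_derivative x * monomial_sum L (t * x, t * y)) (at t)"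
proof (induction L)
  case (Cons d L)
  obtain c j k where d: "d = (c, j, k)" by (cases d)
  have "((\<lambda>t. c / (j + k + 1) * x ^ Suc j * y ^ k * t ^ (j + k + 1)) has_field_derivative
      c / (j + k + 1) * x ^ Suc j * y ^ k * ((j + k + 1) * t ^ (j + k))) (at t)"
    by (rule DERIV_cmult) (use DERIV_pow[of "j + k + 1" t] in simp)
  then have "((\<lambda>t. c / (j + k + 1) * ((t * x) ^ Suc j * (t * y) ^ k)) has_field_derivative
      x * (c * ((t * x) ^ j * (t * y) ^ k))) (at t)"
    by (simp add: power_mult_distrib power_add mult_ac add_ac)
  from DERIV_add[OF this Cons] show ?case
    by (simp add: d antideriv_x_def distrib_left)
qed (simp add: antideriv_x_def)

lemma antideriv_y_derivative:
  "((\<lambda>t. monomial_sum (antideriv_y L) (t * x, t * y)) has_field_derivative y * monomial_sum L (t * x, t * y)) (at t)"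
proof (induction L)
  case (Cons d L)
  obtain c j k where d: "d = (c, j, k)" by (cases d)
  have "((\<lambda>t. c / (j + k + 1) * x ^ j * y ^ Suc k * t ^ (j + k + 1)) has_field_derivative
      c / (j + k + 1) * x ^ j * y ^ Suc k * ((j + k + 1) * t ^ (j + k))) (at t)"
    by (rule DERIV_cmult) (use DERIV_pow[of "j + k + 1" t] in simp)
  then have "((\<lambda>t. c / (j + k + 1) * ((t * x) ^ j * (t * y) ^ Suc k)) has_field_derivative
      y * (c * ((t * x) ^ j * (t * y) ^ k))) (at t)"
    by (simp add: power_mult_distrib power_add mult_ac add_ac)
  from DERIV_add[OF this Cons] show ?case
    by (simp add: d antideriv_y_def distrib_left)
qed (simp add: antideriv_y_def)

lemma monomial_sum_antideriv_0:
  "monomial_sum (antideriv_x L) (0, 0) = 0" "monomial_sum (antideriv_y L) (0, 0) = 0"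
  by (induction L) (auto simp: antideriv_x_def antideriv_y_def)

text \<open>Induction on the order: approximations of both partial derivatives are integrated along
  the ray to \<open>(x, y)\<close>, and the mean value theorem gains one power. These approximations
  need not be the partial derivatives of a common polynomial, which is why primitives along rays are
  used.\<close>

lemma ck_fun_taylor:
  assumes "ck_fun n \<phi>"
  shows "\<exists>L C. C \<ge> 0 \<and> (\<forall>x y. \<bar>x\<bar> \<le> 1 \<longrightarrow> \<bar>y\<bar> \<le> 1 \<longrightarrow>
    \<bar>\<phi> (x, y) - monomial_sum L (x, y)\<bar> \<le> C * (\<bar>x\<bar> + \<bar>y\<bar>) ^ n)"
  using assms
proof (induction n arbitrary: \<phi>)
  case 0
  have "compact (\<phi> ` ({-1..1} \<times> {-1..1}))"
    using ck_fun_imp_continuous_on[OF 0]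
    by (intro compact_continuous_image compact_Times) (auto intro: continuous_on_subset)
  then have "bounded (\<phi> ` ({-1..1} \<times> {-1..1}))" by (rule compact_imp_bounded)
  then obtain C where C: "C > 0" "\<And>p. p \<in> {-1..1} \<times> {-1..1} \<Longrightarrow> \<bar>\<phi> p\<bar> \<le> C"
    unfolding bounded_pos real_norm_def by blast
  have "\<bar>\<phi> (x, y)\<bar> \<le> C" if "\<bar>x\<bar> \<le> 1" "\<bar>y\<bar> \<le> 1" for x y
    using that by (intro C(2)) auto
  with C(1) show ?case
    by (intro exI[of _ "[]"] exI[of _ C]) simp
next
  case (Suc n)
  from Suc.prems obtain \<phi>x \<phi>y where d: "\<forall>p. (\<phi> has_derivative (\<lambda>h. \<phi>x p * fst h + \<phi>y p * snd h)) (at p)"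
    and ck: "ck_fun n \<phi>x" "ck_fun n \<phi>y" by (rule ck_fun_SucE)
  from Suc.IH[OF ck(1)] obtain L1 C1 where L1: "C1 \<ge> 0 \<and> (\<forall>x y. \<bar>x\<bar> \<le> 1 \<longrightarrow> \<bar>y\<bar> \<le> 1 \<longrightarrow>
      \<bar>\<phi>x (x, y) - monomial_sum L1 (x, y)\<bar> \<le> C1 * (\<bar>x\<bar> + \<bar>y\<bar>) ^ n)" by (elim exE)
  from Suc.IH[OF ck(2)] obtain L2 C2 where L2: "C2 \<ge> 0 \<and> (\<forall>x y. \<bar>x\<bar> \<le> 1 \<longrightarrow> \<bar>y\<bar> \<le> 1 \<longrightarrow>
      \<bar>\<phi>y (x, y) - monomial_sum L2 (x, y)\<bar> \<le> C2 * (\<bar>x\<bar> + \<bar>y\<bar>) ^ n)" by (elim exE)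
  have 1: "C1 \<ge> 0" "\<And>x y. \<bar>x\<bar> \<le> 1 \<Longrightarrow> \<bar>y\<bar> \<le> 1 \<Longrightarrow>
      \<bar>\<phi>x (x, y) - monomial_sum L1 (x, y)\<bar> \<le> C1 * (\<bar>x\<bar> + \<bar>y\<bar>) ^ n" using L1 by simp_all
  have 2: "C2 \<ge> 0" "\<And>x y. \<bar>x\<bar> \<le> 1 \<Longrightarrow> \<bar>y\<bar> \<le> 1 \<Longrightarrow>
      \<bar>\<phi>y (x, y) - monomial_sum L2 (x, y)\<bar> \<le> C2 * (\<bar>x\<bar> + \<bar>y\<bar>) ^ n" using L2 by simp_all
  \<comment> \<open>The constant term makes the error \<open>g\<close> below vanish at
    \<open>t = 0\<close>, since the ray primitives vanish at the origin.\<close>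
  define L where "L = (\<phi> (0, 0), 0, 0) # antideriv_x L1 @ antideriv_y L2"
  have "\<bar>\<phi> (x, y) - monomial_sum L (x, y)\<bar> \<le> (C1 + C2) * (\<bar>x\<bar> + \<bar>y\<bar>) ^ Suc n"
    if xy: "\<bar>x\<bar> \<le> 1" "\<bar>y\<bar> \<le> 1" for x y
  proof -
    define g where "g = (\<lambda>t. \<phi> (t * x, t * y) - monomial_sum L (t * x, t * y))"
    define g' where "g' = (\<lambda>t. x * (\<phi>x (t * x, t * y) - monomial_sum L1 (t * x, t * y))
        + y * (\<phi>y (t * x, t * y) - monomial_sum L2 (t * x, t * y)))"
    have "(g has_field_derivative g' t) (at t)" for t
    proof -
      have "((\<lambda>t. (t * x, t * y)) has_derivative (\<lambda>h. (h * x, h * y))) (at t)"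
        by (auto intro!: derivative_eq_intros)
      from has_derivative_compose[OF this d[rule_format]]
      have "((\<lambda>t. \<phi> (t * x, t * y)) has_field_derivative (x * \<phi>x (t * x, t * y) + y * \<phi>y (t * x, t * y))) (at t)"
        by (rule has_derivative_imp_has_field_derivative) (simp add: algebra_simps)
      moreover have "((\<lambda>t. \<phi> (0, 0) + (monomial_sum (antideriv_x L1) (t * x, t * y) + monomial_sum (antideriv_y L2) (t * x, t * y)))
         has_field_derivative 0 + (x * monomial_sum L1 (t * x, t * y) + y * monomial_sum L2 (t * x, t * y))) (at t)"
        by (rule DERIV_add[OF DERIV_const DERIV_add[OF antideriv_x_derivative antideriv_y_derivative]])
      ultimately have "(g has_field_derivative (x * \<phi>x (t * x, t * y) + y * \<phi>y (t * x, t * y)) -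
          (0 + (x * monomial_sum L1 (t * x, t * y) + y * monomial_sum L2 (t * x, t * y)))) (at t)"
        unfolding g_def L_def by (simp only: monomial_sum_Cons monomial_sum_append power_0 mult_1_right) (rule DERIV_diff)
      then show ?thesis by (simp add: g'_def algebra_simps)
    qed
    then obtain z where z: "0 < z" "z < 1" "g 1 - g 0 = (1 - 0) * g' z"
      using MVT2[of 0 1 g g'] by auto
    have "g 0 = 0" by (simp add: g_def L_def monomial_sum_antideriv_0)
    have zx: "\<bar>z * x\<bar> \<le> \<bar>x\<bar>" "\<bar>z * y\<bar> \<le> \<bar>y\<bar>"
      using z by (auto simp: abs_mult intro!: mult_left_le_one_le)
    then have zxy: "\<bar>z * x\<bar> \<le> 1" "\<bar>z * y\<bar> \<le> 1" using xy by auto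
    have "(\<bar>z * x\<bar> + \<bar>z * y\<bar>) ^ n \<le> (\<bar>x\<bar> + \<bar>y\<bar>) ^ n"
      using zx by (intro power_mono) auto
    then have e: "C1 * (\<bar>z * x\<bar> + \<bar>z * y\<bar>) ^ n \<le> C1 * (\<bar>x\<bar> + \<bar>y\<bar>) ^ n"
        "C2 * (\<bar>z * x\<bar> + \<bar>z * y\<bar>) ^ n \<le> C2 * (\<bar>x\<bar> + \<bar>y\<bar>) ^ n"
      using 1(1) 2(1) by (auto intro: mult_left_mono)
    have "\<bar>g 1\<bar> = \<bar>g' z\<bar>" using z(3) \<open>g 0 = 0\<close> by simp
    also have "\<dots> \<le> \<bar>x\<bar> * (C1 * (\<bar>x\<bar> + \<bar>y\<bar>) ^ n) + \<bar>y\<bar> * (C2 * (\<bar>x\<bar> + \<bar>y\<bar>) ^ n)"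
      unfolding g'_def
      by (rule order_trans[OF abs_triangle_ineq], unfold abs_mult, intro add_mono mult_left_mono)
        (auto intro: order_trans[OF 1(2)[OF zxy] e(1)] order_trans[OF 2(2)[OF zxy] e(2)])
    also have "\<dots> \<le> (\<bar>x\<bar> + \<bar>y\<bar>) * (C1 * (\<bar>x\<bar> + \<bar>y\<bar>) ^ n) + (\<bar>x\<bar> + \<bar>y\<bar>) * (C2 * (\<bar>x\<bar> + \<bar>y\<bar>) ^ n)"
      using 1(1) 2(1) by (intro add_mono mult_right_mono) auto
    also have "\<dots> = (C1 + C2) * (\<bar>x\<bar> + \<bar>y\<bar>) ^ Suc n" by (simp add: algebra_simps)
    finally show ?thesis by (simp add: g_def)
  qed
  moreover have "C1 + C2 \<ge> 0" using 1(1) 2(1) by simp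
  ultimately show ?case by (intro exI[of _ L] exI[of _ "C1 + C2"] conjI allI impI)
qed

section \<open>Closure properties of \<open>ck_fun\<close> and the flat function\<close>

lemma ck_fun_const: "ck_fun k (\<lambda>_. c)"
proof (induction k arbitrary: c)
  case (Suc k)
  show ?case by (rule ck_fun_SucI[OF _ Suc[of 0] Suc[of 0]]) (simp add: has_derivative_const)
qed simp

lemma ck_fun_fst: "ck_fun k fst"
proof (cases k)
  case (Suc n)
  show ?thesis unfolding Suc
    by (rule ck_fun_SucI[OF _ ck_fun_const[of n 1] ck_fun_const[of n 0]])
      (auto intro!: derivative_eq_intros)
qed (auto intro: continuous_intros)

lemma ck_fun_snd: "ck_fun k snd"
proof (cases k)
  case (Suc n)
  show ?thesis unfolding Suc
    by (rule ck_fun_SucI[OF _ ck_fun_const[of n 0] ck_fun_const[of n 1]])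
      (auto intro!: derivative_eq_intros)
qed (auto intro: continuous_intros)

lemma ck_fun_add:
  assumes "ck_fun k \<phi>" "ck_fun k \<psi>" shows "ck_fun k (\<lambda>p. \<phi> p + \<psi> p)"
  using assms
proof (induction k arbitrary: \<phi> \<psi>)
  case (Suc k)
  obtain \<phi>x \<phi>y where \<phi>: "\<forall>p. (\<phi> has_derivative (\<lambda>h. \<phi>x p * fst h + \<phi>y p * snd h)) (at p)"
    "ck_fun k \<phi>x" "ck_fun k \<phi>y" using Suc.prems(1) by (rule ck_fun_SucE)
  obtain \<psi>x \<psi>y where \<psi>: "\<forall>p. (\<psi> has_derivative (\<lambda>h. \<psi>x p * fst h + \<psi>y p * snd h)) (at p)"
    "ck_fun k \<psi>x" "ck_fun k \<psi>y" using Suc.prems(2) by (rule ck_fun_SucE)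
  show ?case
  proof (rule ck_fun_SucI)
    show "((\<lambda>p. \<phi> p + \<psi> p) has_derivative (\<lambda>h. (\<phi>x p + \<psi>x p) * fst h + (\<phi>y p + \<psi>y p) * snd h)) (at p)" for p
      using has_derivative_add[OF \<phi>(1)[rule_format, of p] \<psi>(1)[rule_format, of p]] by (simp add: algebra_simps)
  qed (intro Suc.IH \<phi> \<psi>)+
qed (auto intro: continuous_intros)

lemma ck_fun_mult:
  assumes "ck_fun k \<phi>" "ck_fun k \<psi>" shows "ck_fun k (\<lambda>p. \<phi> p * \<psi> p)"
  using assms
proof (induction k arbitrary: \<phi> \<psi>)
  case (Suc k)
  obtain \<phi>x \<phi>y where \<phi>: "\<forall>p. (\<phi> has_derivative (\<lambda>h. \<phi>x p * fst h + \<phi>y p * snd h)) (at p)"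
    "ck_fun k \<phi>x" "ck_fun k \<phi>y" using Suc.prems(1) by (rule ck_fun_SucE)
  obtain \<psi>x \<psi>y where \<psi>: "\<forall>p. (\<psi> has_derivative (\<lambda>h. \<psi>x p * fst h + \<psi>y p * snd h)) (at p)"
    "ck_fun k \<psi>x" "ck_fun k \<psi>y" using Suc.prems(2) by (rule ck_fun_SucE)
  show ?case
  proof (rule ck_fun_SucI)
    show "((\<lambda>p. \<phi> p * \<psi> p) has_derivative
      (\<lambda>h. (\<phi> p * \<psi>x p + \<phi>x p * \<psi> p) * fst h + (\<phi> p * \<psi>y p + \<phi>y p * \<psi> p) * snd h)) (at p)" for p
      using has_derivative_mult[OF \<phi>(1)[rule_format, of p] \<psi>(1)[rule_format, of p]] by (simp add: algebra_simps)
  qed (intro ck_fun_add Suc.IH \<phi> \<psi> Suc.prems[THEN ck_fun_SucD])+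
qed (auto intro: continuous_intros)

lemma ck_fun_power: "ck_fun k \<phi> \<Longrightarrow> ck_fun k (\<lambda>p. \<phi> p ^ n)"
  by (induction n) (auto intro: ck_fun_const ck_fun_mult)

text \<open>The induction on the order needs a whole family such as \<open>t\<^sup>-\<^sup>n exp (- 1 / t)\<close>, since
  differentiation leads out of any single one.\<close>

lemma ck_fun_compose_family:
  fixes F :: "nat \<Rightarrow> real \<Rightarrow> real"
  assumes F: "\<And>n t. t \<in> D \<Longrightarrow> (F n has_field_derivative (\<alpha> n * F (i n) t + \<beta> n * F (l n) t)) (at t)"
    and D: "\<And>p. \<phi> p \<in> D" and "ck_fun k \<phi>"
  shows "ck_fun k (\<lambda>p. F n (\<phi> p))"
  using assms(3)
proof (induction k arbitrary: n)
  case 0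
  have "isCont (\<lambda>p. F n (\<phi> p)) p" for p
  proof (rule isCont_o2[where f = \<phi> and g = "F n"])
    show "isCont \<phi> p" using 0 by (cases p) (simp add: continuous_on_eq_continuous_at)
    show "isCont (F n) (\<phi> p)" by (rule DERIV_isCont[OF F[OF D]])
  qed
  then show ?case by (simp add: continuous_at_imp_continuous_on)
next
  case (Suc k)
  obtain \<phi>x \<phi>y where \<phi>: "\<forall>p. (\<phi> has_derivative (\<lambda>h. \<phi>x p * fst h + \<phi>y p * snd h)) (at p)"
    "ck_fun k \<phi>x" "ck_fun k \<phi>y" using Suc.prems(1) by (rule ck_fun_SucE)
  define E where "E = (\<lambda>p. \<alpha> n * F (i n) (\<phi> p) + \<beta> n * F (l n) (\<phi> p))"
  have E: "ck_fun k E"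
    unfolding E_def by (intro ck_fun_add ck_fun_mult ck_fun_const Suc.IH Suc.prems[THEN ck_fun_SucD])
  show ?case
  proof (rule ck_fun_SucI)
    show "((\<lambda>p. F n (\<phi> p)) has_derivative (\<lambda>h. (E p * \<phi>x p) * fst h + (E p * \<phi>y p) * snd h)) (at p)" for p
      using has_derivative_compose[OF \<phi>(1)[rule_format, of p] F[OF D, unfolded has_field_derivative_def]]
      by (simp add: algebra_simps E_def)
  qed (intro ck_fun_mult E \<phi>)+
qed

lemma DERIV_inverse_power:
  fixes t :: real assumes "t \<noteq> 0"
  shows "((\<lambda>t. inverse t ^ n) has_field_derivative - real n * inverse t ^ Suc n) (at t)"
proof (induction n)
  case (Suc n)
  show ?case
    using DERIV_mult[OF DERIV_inverse[OF assms] Suc] by (simp add: algebra_simps power2_eq_square)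
qed simp

lemma ck_fun_inverse:
  assumes "ck_fun k \<phi>" "\<And>p. \<phi> p \<noteq> 0" shows "ck_fun k (\<lambda>p. inverse (\<phi> p))"
proof -
  \<comment> \<open>The powers of \<open>inverse\<close> form a family closed under differentiation
    with a single term, so \<open>\<beta>\<close> is 0.\<close>
  define F where "F = (\<lambda>n t. inverse (t :: real) ^ n)"
  have "ck_fun k (\<lambda>p. F 1 (\<phi> p))"
  proof (rule ck_fun_compose_family[where F = F and n = 1 and \<phi> = \<phi> and D = "- {0}" and \<alpha> = "\<lambda>n. - real n" and i = Suc and \<beta> = "\<lambda>_. 0" and l = id])
    fix n t assume "t \<in> - {0 :: real}"
    then show "(F n has_field_derivative - real n * F (Suc n) t + 0 * F (id n) t) (at t)"
      using DERIV_inverse_power[of t n] by (simp add: F_def)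
  qed (use assms in simp_all)
  then show ?thesis by (simp add: F_def)
qed

text \<open>\<open>flat 0\<close> is the usual smooth function \<open>exp (-1/t)\<close> extended by
  0; \<open>n\<close> counts the powers of \<open>1/t\<close> created by differentiation.\<close>

definition flat :: "nat \<Rightarrow> real \<Rightarrow> real" where
  "flat n t = (if t > 0 then inverse t ^ n * exp (- inverse t) else 0)"

lemma flat_nonneg: "flat n t \<ge> 0"
  by (simp add: flat_def)

lemma flat_tendsto_0: "(flat n \<longlongrightarrow> 0) (at 0)"
proof -
  have "((\<lambda>t. inverse t ^ n / exp (inverse t)) \<longlongrightarrow> 0) (at_right (0::real))"
    using tendsto_power_div_exp_0 filterlim_inverse_at_top_right by (rule filterlim_compose)
  then have "(flat n \<longlongrightarrow> 0) (at_right 0)"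
    by (rule Lim_transform_eventually)
      (auto simp: flat_def exp_minus field_simps eventually_at_filter)
  moreover have "(flat n \<longlongrightarrow> 0) (at_left 0)"
    by (rule tendsto_eventually) (auto simp: flat_def eventually_at_filter)
  ultimately show ?thesis by (simp add: filterlim_split_at)
qed

lemma flat_has_field_derivative:
  "(flat n has_field_derivative - real n * flat (n + 1) t + 1 * flat (n + 2) t) (at t)"
proof -
  consider "t > 0" | "t < 0" | "t = 0" by linarith
  then show ?thesis
  proof cases
    case 1
    have "((\<lambda>t. inverse t ^ n * exp (- inverse t)) has_field_derivative - real n * flat (n + 1) t + 1 * flat (n + 2) t) (at t)"
    proof -
      have "((\<lambda>t. exp (- inverse t)) has_field_derivative exp (- inverse t) * inverse t ^ 2) (at t)"
        using 1 by (auto intro!: derivative_eq_intros simp: power2_eq_square)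
      from DERIV_mult[OF DERIV_inverse_power[of t n] this] show ?thesis
        using 1 by (simp add: flat_def algebra_simps power2_eq_square)
    qed
    moreover have "\<forall>\<^sub>F s in nhds t. inverse s ^ n * exp (- inverse s) = flat n s"
      using eventually_nhds_in_open[of "{0<..}" t] 1 by (auto elim!: eventually_mono simp: flat_def)
    ultimately show ?thesis by (subst (asm) DERIV_cong_ev[OF refl _ refl])
  next
    case 2
    have "((\<lambda>_. 0) has_field_derivative - real n * flat (n + 1) t + 1 * flat (n + 2) t) (at t)"
      using 2 by (auto simp: flat_def)
    moreover have "\<forall>\<^sub>F s in nhds t. 0 = flat n s"
      using eventually_nhds_in_open[of "{..<0}" t] 2 by (auto elim!: eventually_mono simp: flat_def)
    ultimately show ?thesis by (subst (asm) DERIV_cong_ev[OF refl _ refl])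
  next
    case 3
    \<comment> \<open>For \<open>h \<noteq> 0\<close> the difference quotient of
      \<open>flat n\<close> at 0 is \<open>flat (Suc n) h\<close>.\<close>
    have "((\<lambda>h. (flat n (0 + h) - flat n 0) / h) \<longlongrightarrow> 0) (at 0)"
      using flat_tendsto_0[of "Suc n"]
      by (rule Lim_transform_eventually) (auto simp: flat_def eventually_at_filter field_simps)
    then show ?thesis using 3 by (simp add: DERIV_def flat_def)
  qed
qed

lemma ck_fun_flat: "ck_fun k \<phi> \<Longrightarrow> ck_fun k (\<lambda>p. flat n (\<phi> p))"
  by (rule ck_fun_compose_family[where D = UNIV, OF flat_has_field_derivative]) auto

section \<open>The continuation and its poles\<close>

context weighted_homogeneous_isolated
begin

text \<open>The closed form of the integral over the cut-off Taylor polynomial, which is meaningful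
  beyond the half-plane where that integral is computed.\<close>

definition monomial_zeta :: "(real \<times> nat \<times> nat) list \<Rightarrow> complex \<Rightarrow> complex" where
  "monomial_zeta L (s :: complex) = (\<Sum>(c, j, k)\<leftarrow>L. of_real c * (of_nat a * H j k s / (of_nat m * s + of_real (level_weight j k))))"

lemma monomial_zeta_Nil [simp]: "monomial_zeta [] s = 0"
  and monomial_zeta_Cons [simp]: "monomial_zeta ((c, j, k) # L) (s :: complex) =
    of_real c * (of_nat a * H j k s / (of_nat m * s + of_real (level_weight j k))) + monomial_zeta L s"
  by (auto simp: monomial_zeta_def)

lemma
  fixes s :: complex
  assumes s: "Re s > 0"
  shows integrable_monomial_sum: "integrable lborel (\<lambda>z. complex_of_real \<bar>poly2 f (fst z) (snd z)\<bar> powr s *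
      complex_of_real (monomial_sum L z * indicator {z. N z \<le> 1} z))" (is "?I L")
    and integral_monomial_sum: "(LINT z|lborel. complex_of_real \<bar>poly2 f (fst z) (snd z)\<bar> powr s *
      complex_of_real (monomial_sum L z * indicator {z. N z \<le> 1} z)) = monomial_zeta L s" (is "?E L")
proof -
  have "?I L \<and> ?E L"
  proof (induction L)
    case (Cons t L)
    obtain c j k where t: "t = (c, j, k)" by (cases t)
    let ?h = "\<lambda>z. complex_of_real \<bar>poly2 f (fst z) (snd z)\<bar> powr s *
      complex_of_real (fst z ^ j * snd z ^ k * indicator {z. N z \<le> 1} z)"
    let ?g = "\<lambda>z. complex_of_real \<bar>poly2 f (fst z) (snd z)\<bar> powr s *
      complex_of_real (monomial_sum L z * indicator {z. N z \<le> 1} z)"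
    have e: "complex_of_real \<bar>poly2 f (fst z) (snd z)\<bar> powr s *
        complex_of_real (monomial_sum (t # L) z * indicator {z. N z \<le> 1} z) = of_real c * ?h z + ?g z" for z
      by (simp add: t algebra_simps)
    have I: "integrable lborel (\<lambda>z. of_real c * ?h z)" "integrable lborel ?g"
      using integrable_monomial[OF s, of j k] Cons.IH by (auto intro: integrable_mult_right)
    have "(LINT z|lborel. of_real c * ?h z) = of_real c * (of_nat a * H j k s / (of_nat m * s + of_real (level_weight j k)))"
      using integral_monomial[OF s, of j k] by (simp only: integral_mult_right_zero)
    then show ?case
      unfolding e using Bochner_Integration.integrable_add[OF I] Bochner_Integration.integral_add[OF I] Cons.IH
      by (simp add: t)
  qed simp
  then show "?I L" "?E L" by auto
qed

text \<open>The remainder is dominated by \<open>N powr (m / (2 a b))\<close>, which has weighted order \<open>m\<close> and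
  so pushes the abscissa of convergence below \<open>-1\<close>.\<close>

lemma arch_zeta_expansion:
  assumes [measurable]: "\<phi> \<in> borel_measurable borel" and R: "R > 0"
    and bound: "\<And>z. z \<noteq> 0 \<Longrightarrow> \<bar>\<phi> z - monomial_sum L z * indicator {z. N z \<le> 1} z\<bar>
        \<le> C * N z powr (m / (2 * a * b)) * indicator {z. N z \<le> R} z"
  shows "\<exists>E. E holomorphic_on {s. Re s > -1} \<and> (\<forall>s::complex. Re s > 0 \<longrightarrow> arch_zeta f \<phi> s = E s + monomial_zeta L s)"
proof -
  define r where "r = (\<lambda>z. \<phi> z - monomial_sum L z * indicator {z. N z \<le> 1} z)"
  define E where "E = (\<lambda>s::complex. LINT z|lborel. complex_of_real \<bar>poly2 f (fst z) (snd z)\<bar> powr s * complex_of_real (r z))"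
  have r [measurable]: "r \<in> borel_measurable borel" unfolding r_def by measurable
  have int: "integrable lborel (\<lambda>z. \<bar>poly2 f (fst z) (snd z)\<bar> powr \<sigma> * r z)" if \<sigma>: "\<sigma> > -1" for \<sigma> :: real
  proof (rule integrable_f_powr[OF \<sigma> _ R r])
    show "\<bar>r z\<bar> \<le> C * N z powr (m / (2 * a * b)) * indicator {z. N z \<le> R} z" if "z \<noteq> 0" for z
      using bound[OF that] by (simp only: r_def)
    have "real m * \<sigma> + a + b + m = m * (1 + \<sigma>) + (a + b)" by (simp add: algebra_simps)
    also have "\<dots> > 0" using \<sigma> m_pos a_pos by (intro add_nonneg_pos) auto
    finally show "real m * \<sigma> + a + b + 2 * a * b * (m / (2 * a * b)) > 0"
      using a_pos b_pos by simp
  qed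
  have "E holomorphic_on {s. Re s > -1}"
    unfolding E_def using int by (intro holomorphic_on_integral_powr) auto
  moreover have "arch_zeta f \<phi> s = E s + monomial_zeta L s" if s: "Re s > 0" for s :: complex
  proof -
    have I: "integrable lborel (\<lambda>z. complex_of_real \<bar>poly2 f (fst z) (snd z)\<bar> powr s * complex_of_real (r z))"
      using int[of "Re s"] s by (intro integrable_complex_powr) auto
    have "arch_zeta f \<phi> s = (LINT z|lborel. complex_of_real \<bar>poly2 f (fst z) (snd z)\<bar> powr s * complex_of_real (r z)
       + complex_of_real \<bar>poly2 f (fst z) (snd z)\<bar> powr s * complex_of_real (monomial_sum L z * indicator {z. N z \<le> 1} z))"
      unfolding arch_zeta_def by (intro Bochner_Integration.integral_cong refl) (simp add: r_def algebra_simps)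
    also have "\<dots> = E s + monomial_zeta L s"
      unfolding E_def integral_monomial_sum[OF s, of L, symmetric]
      by (rule Bochner_Integration.integral_add[OF I integrable_monomial_sum[OF s]])
    finally show ?thesis .
  qed
  ultimately show ?thesis by blast
qed

lemma H_analytic_at: "Re (s :: complex) > -1 \<Longrightarrow> H j k analytic_on {s}"
  using holomorphic_H open_halfspace_Re_gt[of "-1"] by (auto simp: analytic_at)

lemma meromorphic_monomial_zeta: "monomial_zeta L meromorphic_on {s. Re s > -1}"
proof (induction L)
  case (Cons t L)
  obtain c j k where t: "t = (c, j, k)" by (cases t)
  have mero: "H j k meromorphic_on {s. Re s > -1}"
    using holomorphic_H open_halfspace_Re_gt[of "-1"]
    by (auto intro!: analytic_on_imp_meromorphic_on simp: analytic_on_open)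
  have "(\<lambda>s. of_real c * (of_nat a * H j k s / (of_nat m * s + of_real (level_weight j k))) + monomial_zeta L s)
      meromorphic_on {s. Re s > -1}"
    by (intro meromorphic_intros mero Cons)
  then show ?case by (simp only: t flip: monomial_zeta_Cons)
qed (simp add: monomial_zeta_def[abs_def] meromorphic_on_const)

text \<open>In the resonant case the zero of \<open>H j k\<close> cancels the simple zero of the
  denominator: the quotient is a difference quotient of \<open>H j k\<close> divided by
  \<open>m\<close>. A finite limit is all that excluding a pole requires.\<close>

lemma monomial_zeta_term_limit:
  fixes s0 :: real
  assumes s0: "s0 > -1" and res: "- real m * s0 = level_weight j k \<Longrightarrow> H j k (of_real s0) = 0"
  shows "\<exists>l. ((\<lambda>s::complex. H j k s / (of_nat m * s + of_real (level_weight j k))) \<longlongrightarrow> l) (at (complex_of_real s0))"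
proof (cases "- real m * s0 = level_weight j k")
  case True
  obtain D where D: "(H j k has_field_derivative D) (at (of_real s0))"
    using H_analytic_at[of "of_real s0" j k] s0 analytic_on_imp_differentiable_at
    by (force simp: field_differentiable_def)
  have lw: "complex_of_real (level_weight j k) = - (m * of_real s0)"
    by (simp flip: True)
  have "((\<lambda>s::complex. (H j k s - H j k (of_real s0)) / (s - of_real s0) / m) \<longlongrightarrow> D / m) (at (of_real s0))"
    using D m_pos by (intro tendsto_divide tendsto_const) (auto simp: has_field_derivative_iff)
  also have "(\<lambda>s::complex. (H j k s - H j k (of_real s0)) / (s - of_real s0) / m) = (\<lambda>s::complex. H j k s / (of_nat m * s + of_real (level_weight j k)))"
    using res[OF True] by (simp add: lw algebra_simps)
  finally show ?thesis by blast
next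
  case False
  have nz: "m * complex_of_real s0 + level_weight j k \<noteq> 0"
  proof
    assume "m * complex_of_real s0 + level_weight j k = 0"
    then have "complex_of_real (m * s0 + level_weight j k) = 0" by simp
    then have "m * s0 + level_weight j k = 0" by (simp only: of_real_eq_0_iff)
    then show False using False by simp
  qed
  have "(H j k \<longlongrightarrow> H j k (of_real s0)) (at (of_real s0))"
    using analytic_at_imp_isCont[OF H_analytic_at[of "of_real s0" j k]] s0 by (simp add: isCont_def)
  then have "((\<lambda>s::complex. H j k s / (of_nat m * s + of_real (level_weight j k))) \<longlongrightarrow> H j k (of_real s0) / (of_nat m * of_real s0 + of_real (level_weight j k)))
      (at (complex_of_real s0))"
    using nz by (intro tendsto_intros)
  then show ?thesis by blast
qed

lemma monomial_zeta_limit: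
  fixes s0 :: real
  assumes s0: "s0 > -1" and res: "\<And>j k. - real m * s0 = level_weight j k \<Longrightarrow> H j k (of_real s0) = 0"
  shows "\<exists>l. (monomial_zeta L \<longlongrightarrow> l) (at (complex_of_real s0))"
proof (induction L)
  case (Cons t L)
  obtain c j k where t: "t = (c, j, k)" by (cases t)
  obtain l1 where 1: "((\<lambda>s::complex. H j k s / (of_nat m * s + of_real (level_weight j k))) \<longlongrightarrow> l1) (at (complex_of_real s0))"
    using monomial_zeta_term_limit[OF s0 res] by blast
  obtain l2 where 2: "(monomial_zeta L \<longlongrightarrow> l2) (at (complex_of_real s0))"
    using Cons by blast
  have "((\<lambda>s::complex. of_real c * (a * (H j k s / (of_nat m * s + of_real (level_weight j k)))) + monomial_zeta L s)
      \<longlongrightarrow> of_real c * (a * l1) + l2) (at (complex_of_real s0))"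
    by (intro tendsto_add tendsto_mult tendsto_const 1 2)
  then show ?case
    unfolding t by (intro exI[of _ "of_real c * (a * l1) + l2"]) simp
qed (auto simp: monomial_zeta_def[abs_def])

lemma monomial_zeta_pole:
  fixes s0 :: real
  assumes s0: "s0 > -1" and res: "- real m * s0 = level_weight j k" and H: "H j k (of_real s0) \<noteq> 0"
  shows "is_pole (monomial_zeta [(1, j, k)]) (complex_of_real s0)"
proof -
  have "is_pole (\<lambda>s::complex. a * H j k s / (of_nat m * s + of_real (level_weight j k))) (complex_of_real s0)"
  proof (rule is_pole_divide)
    show "isCont (\<lambda>s::complex. a * H j k s) (complex_of_real s0)"
      using analytic_at_imp_isCont[OF H_analytic_at[of "of_real s0" j k]] s0 by (intro continuous_intros) simp
    have lw: "complex_of_real (level_weight j k) = - (m * of_real s0)"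
      by (simp flip: res)
    show "filterlim (\<lambda>s::complex. m * s + complex_of_real (level_weight j k)) (at 0) (at (complex_of_real s0))"
      unfolding filterlim_at
    proof
      show "\<forall>\<^sub>F s in at (complex_of_real s0). m * s + complex_of_real (level_weight j k) \<in> UNIV \<and>
          m * s + complex_of_real (level_weight j k) \<noteq> 0"
        using m_pos by (auto simp: eventually_at_filter lw)
      show "((\<lambda>s::complex. m * s + complex_of_real (level_weight j k)) \<longlongrightarrow> 0) (at (complex_of_real s0))"
        by (auto intro!: tendsto_eq_intros simp: lw)
    qed
    show "a * H j k (complex_of_real s0) \<noteq> 0" using a_pos H by simp
  qed
  then show ?thesis by (simp add: monomial_zeta_def[abs_def])
qed

end

text \<open>Identity theorem: off a sparse set, the difference of two continuations is either
  everywhere 0 or nowhere 0, and near the point 1 both equal the integral.\<close>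

lemma arch_zeta_continuation_unique:
  fixes s0 :: complex
  assumes "arch_zeta_continuation f \<phi> F" "arch_zeta_continuation f \<phi> F'" "Re s0 > -1"
  shows "\<forall>\<^sub>F s in at s0. F s = F' s"
proof -
  define A where "A = {s :: complex. Re s > -1}"
  have A: "open A" "connected A"
    unfolding A_def by (auto intro: open_halfspace_Re_gt convex_connected convex_halfspace_Re_gt)
  have "(\<lambda>s::complex. F s - F' s) meromorphic_on A"
    using assms unfolding arch_zeta_continuation_def A_def by (intro meromorphic_intros) auto
  then consider "\<forall>\<^sub>F s in cosparse A. F s - F' s = 0" | "\<forall>\<^sub>F s in cosparse A. F s - F' s \<noteq> 0"
    using meromorphic_imp_constant_or_avoid[OF _ A] by blast
  then show ?thesis
  proof cases
    case 1
    then have "\<forall>\<^sub>F s in at s0. F s - F' s = 0"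
      using A assms(3) by (auto simp: eventually_cosparse_open_eq A_def)
    then show ?thesis by eventually_elim simp
  next
    case 2
    then have "\<forall>\<^sub>F s in at 1. F s - F' s \<noteq> 0"
      using A by (auto simp: eventually_cosparse_open_eq A_def)
    moreover have "\<forall>\<^sub>F s in at (1::complex). s \<in> {s. Re s > 0}"
      by (intro eventually_at_in_open' open_halfspace_Re_gt) auto
    ultimately have "\<forall>\<^sub>F s in at (1::complex). False"
      by eventually_elim (use assms(1,2) in \<open>auto simp: arch_zeta_continuation_def\<close>)
    then show ?thesis by simp
  qed
qed

section \<open>Smooth cutoff, expansion of test functions and the pole criterion\<close>

context weighted_homogeneous_isolated
begin

lemma compact_N_sublevel: "compact {z. N z \<le> R}"
proof -
  \<comment> \<open>The bound works because \<open>t ^ (2 * n)\<close> dominates \<open>|t|\<close>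
    once \<open>|t| > 1\<close>.\<close>
  define K where "K = max 1 R"
  have le: "\<bar>t\<bar> \<le> K" if "t ^ (2 * n) \<le> R" "n > 0" for t :: real and n
  proof (cases "\<bar>t\<bar> \<le> 1")
    case False
    then have "\<bar>t\<bar> ^ 1 \<le> \<bar>t\<bar> ^ (2 * n)" using that(2) by (intro power_increasing) auto
    then show ?thesis using that(1) by (simp add: K_def power_even_abs)
  qed (simp add: K_def)
  have "{z. N z \<le> R} \<subseteq> {-K..K} \<times> {-K..K}"
  proof
    fix z assume "z \<in> {z. N z \<le> R}"
    moreover have "fst z ^ (2 * b) \<ge> 0" "snd z ^ (2 * a) \<ge> 0" by simp_all
    ultimately have "fst z ^ (2 * b) \<le> R" "snd z ^ (2 * a) \<le> R" unfolding N_def mem_Collect_eq by linarith+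
    then have "\<bar>fst z\<bar> \<le> K" "\<bar>snd z\<bar> \<le> K" using le a_pos b_pos by blast+
    then show "z \<in> {-K..K} \<times> {-K..K}" by (cases z) (simp add: abs_le_iff; linarith)
  qed
  then have "bounded {z. N z \<le> R}"
    by (rule bounded_subset[rotated]) (auto intro: compact_imp_bounded compact_Times)
  moreover have "closed {z. N z \<le> R}"
    by (intro closed_Collect_le continuous_intros)
  ultimately show ?thesis by (simp add: compact_eq_bounded_closed)
qed

text \<open>The standard quotient of flat functions, equal to 1 on the region of the sharp cutoff
  and to 0 for \<open>N \<ge> 2\<close>.\<close>

definition cutoff :: "real \<times> real \<Rightarrow> real" where
  "cutoff z = flat 0 (2 - N z) * inverse (flat 0 (2 - N z) + flat 0 (N z - 1))"

lemma cutoff_denominator: "flat 0 (2 - N z) + flat 0 (N z - 1) > 0"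
  by (cases "N z < 2") (auto simp: flat_def add_pos_nonneg)

lemma cutoff_eq_1: "N z \<le> 1 \<Longrightarrow> cutoff z = 1"
  by (simp add: cutoff_def flat_def)

lemma cutoff_eq_0: "N z \<ge> 2 \<Longrightarrow> cutoff z = 0"
  by (simp add: cutoff_def flat_def)

lemma cutoff_bounds: "0 \<le> cutoff z" "cutoff z \<le> 1"
  using cutoff_denominator[of z] flat_nonneg[of 0 "2 - N z"] flat_nonneg[of 0 "N z - 1"]
  by (auto simp: cutoff_def field_simps)

lemma ck_fun_cutoff: "ck_fun n cutoff"
proof -
  have N: "ck_fun n N"
    unfolding N_def[abs_def] by (intro ck_fun_add ck_fun_power ck_fun_fst ck_fun_snd)
  have 0: "ck_fun n (\<lambda>p. 2 + (- 1) * N p)" "ck_fun n (\<lambda>p. N p + (- 1))"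
    by (intro ck_fun_add ck_fun_mult ck_fun_const N)+
  have 1: "ck_fun n (\<lambda>p. flat 0 (2 - N p))" "ck_fun n (\<lambda>p. flat 0 (N p - 1))"
    using ck_fun_flat[OF 0(1), of 0] ck_fun_flat[OF 0(2), of 0] by simp_all
  have 2: "flat 0 (2 - N p) + flat 0 (N p - 1) \<noteq> 0" for p
    using cutoff_denominator[of p] by simp
  show ?thesis
    unfolding cutoff_def[abs_def] by (intro ck_fun_mult ck_fun_inverse ck_fun_add 1 2)
qed

lemma test_function_monomial_cutoff:
  "test_function (\<lambda>z. fst z ^ j * snd z ^ k * cutoff z)"
  unfolding test_function_def
proof (intro conjI allI)
  show "ck_fun n (\<lambda>z. fst z ^ j * snd z ^ k * cutoff z)" for n
    by (intro ck_fun_mult ck_fun_power ck_fun_fst ck_fun_snd ck_fun_cutoff)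
  have "{p. fst p ^ j * snd p ^ k * cutoff p \<noteq> 0} \<subseteq> {z. N z \<le> 2}"
  proof
    fix p assume "p \<in> {p. fst p ^ j * snd p ^ k * cutoff p \<noteq> 0}"
    then have "cutoff p \<noteq> 0" by simp
    then have "\<not> N p \<ge> 2" using cutoff_eq_0 by blast
    then show "p \<in> {z. N z \<le> 2}" by simp
  qed
  then have "closure {p. fst p ^ j * snd p ^ k * cutoff p \<noteq> 0} \<subseteq> {z. N z \<le> 2}"
    using compact_N_sublevel[of 2] by (intro closure_minimal compact_imp_closed)
  then show "compact (closure {p. fst p ^ j * snd p ^ k * cutoff p \<noteq> 0})"
    using compact_Int_closed[OF compact_N_sublevel[of 2] closed_closure[of "{p. fst p ^ j * snd p ^ k * cutoff p \<noteq> 0}"]]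
    by (simp only: Int_absorb1)
qed

lemma test_function_borel: "test_function \<phi> \<Longrightarrow> \<phi> \<in> borel_measurable borel"
  unfolding test_function_def by (blast intro: borel_measurable_continuous_onI ck_fun_imp_continuous_on)

text \<open>Smooth and sharp cutoff differ only for \<open>1 < N < 2\<close>, away from the origin,
  where a nonnegative power of \<open>N\<close> is at least 1 and boundedness suffices.\<close>

lemma monomial_cutoff_expansion:
  "\<exists>E. E holomorphic_on {s. Re s > -1} \<and>
    (\<forall>s::complex. Re s > 0 \<longrightarrow> arch_zeta f (\<lambda>z. fst z ^ j * snd z ^ k * cutoff z) s = E s + monomial_zeta [(1, j, k)] s)"
proof -
  have "compact ((\<lambda>z. fst z ^ j * snd z ^ k) ` {z. N z \<le> 2})"
    by (intro compact_continuous_image compact_N_sublevel continuous_intros)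
  then have "bounded ((\<lambda>z. fst z ^ j * snd z ^ k) ` {z. N z \<le> 2})" by (rule compact_imp_bounded)
  then obtain C where C: "C > 0" "\<And>z. z \<in> {z. N z \<le> 2} \<Longrightarrow> \<bar>fst z ^ j * snd z ^ k\<bar> \<le> C"
    unfolding bounded_pos real_norm_def by blast
  show ?thesis
  proof (rule arch_zeta_expansion[where R = 2 and C = C])
    show "(\<lambda>z. fst z ^ j * snd z ^ k * cutoff z) \<in> borel_measurable borel"
      by (rule test_function_borel[OF test_function_monomial_cutoff])
    fix z
    show "\<bar>fst z ^ j * snd z ^ k * cutoff z - monomial_sum [(1, j, k)] z * indicator {z. N z \<le> 1} z\<bar>
      \<le> C * N z powr (m / (2 * a * b)) * indicator {z. N z \<le> 2} z"
    proof -
      consider "N z \<le> 1" | "N z > 1" "N z \<le> 2" | "N z > 2" by linarith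
      then show ?thesis
      proof cases
        case 1
        then show ?thesis using C(1) by (simp add: cutoff_eq_1)
      next
        case 2
        have "1 powr (m / (2 * a * b)) \<le> N z powr (m / (2 * a * b))"
          using 2 by (intro powr_mono2) auto
        then have "C * 1 \<le> C * N z powr (m / (2 * a * b))"
          using C(1) by (intro mult_left_mono) auto
        moreover have "\<bar>fst z ^ j * snd z ^ k\<bar> * cutoff z \<le> C * 1"
          using C(2)[of z] C(1) 2 cutoff_bounds[of z] by (intro mult_mono) auto
        ultimately show ?thesis
          using 2 cutoff_bounds[of z] by (simp add: abs_mult)
      next
        case 3
        then show ?thesis using cutoff_eq_0[of z] by simp
      qed
    qed
  qed simp
qed

text \<open>Taylor order \<open>m\<close> matches the weight demanded of the remainder: for
  \<open>N \<le> 1\<close> both coordinates are at most \<open>N powr (1/2ab)\<close>, so the error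
  is a multiple of \<open>N powr (m/2ab)\<close>. For \<open>N > 1\<close> only boundedness and
  compact support of the test function matter.\<close>

lemma test_function_expansion:
  assumes "test_function \<phi>"
  shows "\<exists>L E. E holomorphic_on {s. Re s > -1} \<and>
    (\<forall>s::complex. Re s > 0 \<longrightarrow> arch_zeta f \<phi> s = E s + monomial_zeta L s)"
proof -
  have ck: "ck_fun m \<phi>" and supp: "compact (closure {p. \<phi> p \<noteq> 0})"
    using assms by (auto simp: test_function_def)
  from ck_fun_taylor[OF ck] obtain L C where LC: "C \<ge> 0 \<and> (\<forall>x y. \<bar>x\<bar> \<le> 1 \<longrightarrow> \<bar>y\<bar> \<le> 1 \<longrightarrow>
    \<bar>\<phi> (x, y) - monomial_sum L (x, y)\<bar> \<le> C * (\<bar>x\<bar> + \<bar>y\<bar>) ^ m)" by (elim exE)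
  let ?S = "closure {p. \<phi> p \<noteq> 0}"
  have "bounded (\<phi> ` ?S)"
    by (intro compact_imp_bounded compact_continuous_image supp
        continuous_on_subset[OF ck_fun_imp_continuous_on[OF ck]] subset_UNIV)
  moreover have "bounded (N ` ?S)"
    by (intro compact_imp_bounded compact_continuous_image supp continuous_on_N)
  ultimately obtain B R where B: "B > 0" "\<And>p. p \<in> ?S \<Longrightarrow> \<bar>\<phi> p\<bar> \<le> B" and R: "R > 0" "\<And>p. p \<in> ?S \<Longrightarrow> \<bar>N p\<bar> \<le> R"
    unfolding bounded_pos real_norm_def by blast
  have sub: "p \<in> ?S" if "\<phi> p \<noteq> 0" for p
    using that by (intro subsetD[OF closure_subset]) simp
  \<comment> \<open>A common lower bound of \<open>1/2a\<close> and \<open>1/2b\<close>; lowering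
    the exponent is legitimate where \<open>N z \<le> 1\<close>.\<close>
  define q where "q = 1 / (2 * real a * real b)"
  \<comment> \<open>The maximum with 1 makes the region contain \<open>{N \<le> 1}\<close>, where
    the polynomial part lives.\<close>
  have "\<bar>\<phi> z - monomial_sum L z * indicator {z. N z \<le> 1} z\<bar>
      \<le> (C * 2 ^ m + B) * N z powr (m / (2 * a * b)) * indicator {z. N z \<le> max R 1} z" if "z \<noteq> 0" for z
  proof (cases "N z \<le> 1")
    case True
    have Npos: "N z > 0" using N_pos[OF that] .
    have root: "\<bar>t\<bar> \<le> N z powr q" if "t ^ (2 * n) \<le> N z" "n = a \<or> n = b" for t n
    proof -
      have "\<bar>t\<bar> = (\<bar>t\<bar> ^ (2 * n)) powr (1 / (2 * n))"
      proof (cases "t = 0")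
        case False
        then show ?thesis using a_pos b_pos that(2) by (auto simp: powr_realpow[symmetric] powr_powr simp del: power_even_abs)
      qed (use a_pos b_pos that(2) in auto)
      also have "\<dots> \<le> N z powr (1 / (2 * n))"
        using that by (intro powr_mono2) (auto simp: power_even_abs)
      also have "\<dots> \<le> N z powr q"
        using that(2) a_pos b_pos True Npos
        by (intro powr_mono') (auto simp: q_def field_simps)
      finally show ?thesis .
    qed
    have "fst z ^ (2 * b) \<ge> 0" "snd z ^ (2 * a) \<ge> 0" by simp_all
    then have "fst z ^ (2 * b) \<le> N z" "snd z ^ (2 * a) \<le> N z" unfolding N_def by linarith+
    then have xy: "\<bar>fst z\<bar> \<le> N z powr q" "\<bar>snd z\<bar> \<le> N z powr q" using root by blast+
    have "N z powr q \<le> 1 powr q" using True by (intro powr_mono2) (auto simp: q_def)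
    then have xy1: "\<bar>fst z\<bar> \<le> 1" "\<bar>snd z\<bar> \<le> 1" using xy by auto
    have "(\<bar>fst z\<bar> + \<bar>snd z\<bar>) ^ m \<le> (2 * N z powr q) ^ m"
      using xy by (intro power_mono) auto
    also have "\<dots> = 2 ^ m * N z powr (m / (2 * a * b))"
      using Npos by (simp add: power_mult_distrib powr_realpow[symmetric] powr_powr q_def)
    finally have "C * (\<bar>fst z\<bar> + \<bar>snd z\<bar>) ^ m \<le> C * (2 ^ m * N z powr (m / (2 * a * b)))"
      using LC by (intro mult_left_mono) auto
    moreover have "\<bar>\<phi> z - monomial_sum L z\<bar> \<le> C * (\<bar>fst z\<bar> + \<bar>snd z\<bar>) ^ m"
      using LC xy1 by (metis prod.collapse)
    moreover have "0 \<le> B * N z powr (m / (2 * a * b))" using B(1) by simp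
    ultimately show ?thesis using True by (simp add: distrib_right mult.assoc)
  next
    case False
    have "\<bar>\<phi> z\<bar> \<le> B * indicator {z. N z \<le> max R 1} z"
    proof (cases "\<phi> z = 0")
      case True
      then show ?thesis using B(1) by simp
    next
      case False
      then show ?thesis using B(2)[OF sub[OF False]] R(2)[OF sub[OF False]] by simp
    qed
    also have "\<dots> \<le> ((C * 2 ^ m + B) * N z powr (m / (2 * a * b))) * indicator {z. N z \<le> max R 1} z"
    proof (rule mult_right_mono)
      have "1 powr (m / (2 * a * b)) \<le> N z powr (m / (2 * a * b))"
        using False by (intro powr_mono2) auto
      then have "B * 1 \<le> (C * 2 ^ m + B) * N z powr (m / (2 * a * b))"
        using B(1) LC by (intro mult_mono) auto
      then show "B \<le> (C * 2 ^ m + B) * N z powr (m / (2 * a * b))" by simp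
    qed simp
    finally show ?thesis using False by simp
  qed
  then show ?thesis
    by (intro exI[of _ L] arch_zeta_expansion[OF test_function_borel[OF assms], of "max R 1"]) simp_all
qed

lemma expansion_continuation:
  assumes "E holomorphic_on {s. Re s > -1}" "\<And>s :: complex. Re s > 0 \<Longrightarrow> arch_zeta f \<phi> s = E s + monomial_zeta L s"
  shows "arch_zeta_continuation f \<phi> (\<lambda>s. E s + monomial_zeta L s)"
  unfolding arch_zeta_continuation_def
proof
  have "E analytic_on {s. Re s > -1}"
    using assms(1) open_halfspace_Re_gt[of "-1"] by (simp add: analytic_on_open)
  then show "(\<lambda>s. E s + monomial_zeta L s) meromorphic_on {s. Re s > -1}"
    by (intro meromorphic_on_add meromorphic_monomial_zeta analytic_on_imp_meromorphic_on)
qed (use assms(2) in auto)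

lemma holomorphic_tendsto:
  assumes "E holomorphic_on {s. Re s > -1}" "s0 > -1"
  shows "(E \<longlongrightarrow> E (complex_of_real s0)) (at (complex_of_real s0))"
proof -
  have "continuous_on {s. Re s > -1} E" using assms(1) by (rule holomorphic_on_imp_continuous_on)
  then have "isCont E (complex_of_real s0)"
    using assms(2) by (simp add: continuous_on_eq_continuous_at open_halfspace_Re_gt)
  then show ?thesis by (simp add: isCont_def)
qed

theorem pole_iff:
  fixes s0 :: real
  assumes s0: "s0 > -1"
  shows "(\<exists>\<phi> F. test_function \<phi> \<and> arch_zeta_continuation f \<phi> F \<and> is_pole F (complex_of_real s0)) \<longleftrightarrow>
    (\<exists>j k. - real m * s0 = level_weight j k \<and> H j k (complex_of_real s0) \<noteq> 0)"
proof
  assume "\<exists>\<phi> F. test_function \<phi> \<and> arch_zeta_continuation f \<phi> F \<and> is_pole F (complex_of_real s0)"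
  then obtain \<phi> F where \<phi>: "test_function \<phi>" and F: "arch_zeta_continuation f \<phi> F" "is_pole F (complex_of_real s0)"
    by blast
  obtain L E where E: "E holomorphic_on {s. Re s > -1}"
    "\<And>s::complex. Re s > 0 \<Longrightarrow> arch_zeta f \<phi> s = E s + monomial_zeta L s"
    using test_function_expansion[OF \<phi>] by blast
  show "\<exists>j k. - real m * s0 = level_weight j k \<and> H j k (complex_of_real s0) \<noteq> 0"
  proof (rule ccontr)
    assume "\<not> ?thesis"
    then have H0: "H j k (complex_of_real s0) = 0" if "- real m * s0 = level_weight j k" for j k
      using that by simp
    have "\<exists>l. (monomial_zeta L \<longlongrightarrow> l) (at (complex_of_real s0))"
      by (rule monomial_zeta_limit[OF s0]) (rule H0)
    then obtain l where "(monomial_zeta L \<longlongrightarrow> l) (at (complex_of_real s0))" ..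
    from tendsto_add[OF holomorphic_tendsto[OF E(1) s0] this]
    have lim: "((\<lambda>s. E s + monomial_zeta L s) \<longlongrightarrow> E (of_real s0) + l) (at (complex_of_real s0))" .
    \<comment> \<open>The pole of an arbitrary \<open>F\<close> passes to the explicit expansion,
      which agrees with it on a punctured neighbourhood.\<close>
    have "is_pole (\<lambda>s. E s + monomial_zeta L s) (complex_of_real s0)"
      using is_pole_cong[OF arch_zeta_continuation_unique[OF F(1) expansion_continuation[OF E]] refl] F(2) s0
      by simp
    then show False
      using lim not_tendsto_and_filterlim_at_infinity[OF _ lim] by (auto simp: is_pole_def)
  qed
next
  assume "\<exists>j k. - real m * s0 = level_weight j k \<and> H j k (complex_of_real s0) \<noteq> 0"
  then obtain j k where jk: "- real m * s0 = level_weight j k" "H j k (complex_of_real s0) \<noteq> 0" by blast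
  obtain E where E: "E holomorphic_on {s. Re s > -1}"
    "\<And>s::complex. Re s > 0 \<Longrightarrow>
      arch_zeta f (\<lambda>z. fst z ^ j * snd z ^ k * cutoff z) s = E s + monomial_zeta [(1, j, k)] s"
    using monomial_cutoff_expansion by blast
  have "is_pole (\<lambda>s. E s + monomial_zeta [(1, j, k)] s) (complex_of_real s0)"
    unfolding is_pole_def
    by (rule tendsto_add_filterlim_at_infinity[OF holomorphic_tendsto[OF E(1) s0]
          monomial_zeta_pole[OF s0 jk, unfolded is_pole_def]])
  then show "\<exists>\<phi> F. test_function \<phi> \<and> arch_zeta_continuation f \<phi> F \<and> is_pole F (complex_of_real s0)"
    using test_function_monomial_cutoff expansion_continuation[OF E] by blast
qed

end

theorem theorem1p5:
  fixes a b m :: nat and f :: "real poly poly" and s0 :: real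
  assumes "a > 0" and "b > 0" and "m > 0"
    and "weighted_homogeneous a b m f"
    and "isolated_singularity_at_origin f"
    and "-1 < s0" and "s0 < 0"
    and "poly (bernstein_sato_poly f) s0 = 0"
  shows "(\<exists>\<phi> F. test_function \<phi> \<and> arch_zeta_continuation f \<phi> F \<and> is_pole F (complex_of_real s0))
     \<longleftrightarrow>
     (\<exists>j k :: nat.
        - real m * s0 = (real j + 1) * real a + (real k + 1) * real b \<and>
        (LINT u|lborel. (\<bar>poly2 f 1 u\<bar> powr s0 + (-1) ^ j * \<bar>poly2 f (-1) u\<bar> powr s0) * u ^ k) \<noteq> 0)"
proof -
  interpret weighted_homogeneous_isolated a b m f
    by unfold_locales (use assms(1-5) in \<open>simp_all add: isolated_singularity_at_origin_def\<close>)
  have "- real m * s0 = level_weight j k \<and> H j k (complex_of_real s0) \<noteq> 0 \<longleftrightarrow>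
      - real m * s0 = (real j + 1) * real a + (real k + 1) * real b \<and>
      (LINT u|lborel. (\<bar>poly2 f 1 u\<bar> powr s0 + (-1) ^ j * \<bar>poly2 f (-1) u\<bar> powr s0) * u ^ k) \<noteq> 0" for j k
  proof (rule conj_cong)
    \<comment> \<open>Only at a resonance is \<open>H j k\<close> at \<open>s0\<close> identified
      with the integral of (2), so the first conjunct has to be available here.\<close>
    assume "- real m * s0 = (real j + 1) * real a + (real k + 1) * real b"
    then have res: "- real m * s0 = level_weight j k" by (simp only: level_weight_def)
    show "H j k (complex_of_real s0) \<noteq> 0 \<longleftrightarrow>
      (LINT u|lborel. (\<bar>poly2 f 1 u\<bar> powr s0 + (-1) ^ j * \<bar>poly2 f (-1) u\<bar> powr s0) * u ^ k) \<noteq> 0"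
      by (simp only: H_resonant[OF \<open>-1 < s0\<close> res] of_real_eq_0_iff)
  qed (simp only: level_weight_def)
  then show ?thesis
    by (simp only: pole_iff[OF \<open>-1 < s0\<close>])
qed

end
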